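(* Fix $0\le\beta\le 1/2$ and consider the stochastic coupon probing problem $\mathbf{P.A}$ described in the context. Let $\mathrm{OPT}=\sup_\pi f(\pi)$, the supremum being over all probing policies $\pi$ feasible for $\mathbf{P.A}$. Then the policy $\textsc{stoch-CP}$ (with parameter $\beta$) satisfies \[ f(\textsc{stoch-CP}) \;\ge\; \frac{(1-1/e)(1-\beta)(1-2\beta)\beta}{2}\,\mathrm{OPT}. \]
   Context: Model. $\mathcal{V}$ is a finite set of users and $\mathcal{C}$ a finite set of coupons, each identified with its nonnegative value. For every $v\in\mathcal{V}$, $c\in\mathcal{C}$ there is an attractiveness $p_{v,c}\in[0,1]$, with $p_{v,c}\le p_{v,c'}$ whenever $c\le c'$. Each user $v$ independently draws a threshold $\sigma_v$ uniformly from $[0,1]$ and accepts coupon $c$ iff $p_{v,c}\ge\sigma_v$ (so $v$ accepts $c$ with probability $p_{v,c}$, and acceptances of different coupons by the same user are correlated through $\sigma_v$). $I:2^{\mathcal{V}}\to\mathbb{R}_{\ge0}$ is a monotone submodular function with $I(\emptyset)=0$ (the expected influence of a seed set). An action $(v,c)$ offers coupon $c$ to user $v$ and reveals whether $v$ accepts; if she accepts, $v$ becomes a seed and the value $c$ is paid (redeemed), otherwise nothing is paid. A probing policy adaptively chooses the next action as a function of the outcomes observed so far (possibly using internal randomness) and finally outputs the set $\mathcal{U}$ of users who accepted; its utility is $f(\pi)=\mathbb{E}[I(\mathcal{U})]$. Problem $\mathbf{P.A}$: maximize $f(\pi)$ over policies that, with probability one, probe each user at most $K$ times ($K$ a nonnegative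 integer constant; outer constraint) and redeem coupons of total value at most $B\ge 0$ (inner constraint). ALG I. Let $\mathcal{C}_l=\{c\in\mathcal{C}: c\le B/2\}$, sorted in nondecreasing order, and let $\Psi$ be the set of subsequences of $\mathcal{C}_l$ of length at most $K$. Let $\mathcal{S}=\mathcal{V}\times\Psi$; the action $(v,\psi)\in\mathcal{S}$ means offering the coupons of $\psi$ to $v$ one by one in order, stopping at the first acceptance (paying that coupon) or when $\psi$ is exhausted. Let $b_{v\psi}$ be the expected value paid when executing $(v,\psi)$. For $A\subseteq\mathcal{S}$ let $f(A)=\mathbb{E}[I(\{v:\exists (v,\psi)\in A \text{ such that } v \text{ accepts some coupon of } \psi\})]$. The continuous greedy procedure: set $\delta=1/(|\mathcal{V}||\Psi|)^2$, $\mathbf{y}(0)=\mathbf{0}$; for $t=0,\delta,2\delta,\dots$ while $t<1$: let $R(t)$ contain each $(v,\psi)$ independently with probability $y_{v\psi}(t)$, let $\omega_{v\psi}=\mathbb{E}[f(R(t)\cup\{(v,\psi)\})]-\mathbb{E}[f(R(t))]$, let $\mathbf{y}^*$ be an optimal solution of the linear program maximizing $\sum_{(v,\psi)\in\mathcal{S}}\omega_{v\psi}y_{v\psi}$ subject to $\sum_{\psi\in\Psi}y_{v\psi}\le1$ for all $v$, $\sum_{(v,\psi)\in\mathcal{S}}y_{v\psi}b_{v\psi}\le\beta B$, $0\le y_{v\psi}\le1$; set $\mathbf{y}(t+\delta)=\mathbf{y}(t)+\delta\mathbf{y}^*$. Let $\mathbf{y}^g$ be the final vector. Then: (1) let $R$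 contain each $(v,\psi)$ independently with probability $y^g_{v\psi}$; (2) apply a contention resolution scheme (in the sense of Vondrák–Chekuri–Zenklusen) for the partition matroid "at most one action per user" to $R$, obtaining $\mathcal{Z}\subseteq R$ with at most one action per user; (3) consider the actions of $\mathcal{Z}$ one by one in arbitrary order, executing the current action if the remaining budget is at least $B/2$ (deducting any redeemed coupon from the budget) and discarding it otherwise. ALG II. Let $c_{\max}=\max\mathcal{C}$. Sort users in nonincreasing order of $I(\{v\})$ and offer $c_{\max}$ to them one by one in this order, stopping as soon as a user accepts (or after the last user rejects). $\textsc{stoch-CP}$: run ALG I or ALG II, each chosen with probability $1/2$. *)

theory Defs
  imports "HOL-Probability.Probability"
begin

type_synonym 'v hist = "('v \<times> real \<times> bool) list"
  \<comment> \<open>history of actions (user, coupon offered, accepted?)\<close>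
type_synonym 'v policy = "'v hist \<Rightarrow> ('v \<times> real) option"
  \<comment> \<open>deterministic adaptive policy: next action from observed history, None = stop\<close>

definition monotone_submodular :: "'v set \<Rightarrow> ('v set \<Rightarrow> real) \<Rightarrow> bool" where
  "monotone_submodular V I \<longleftrightarrow>
     I {} = 0 \<and> (\<forall>A. A \<subseteq> V \<longrightarrow> 0 \<le> I A) \<and>
     (\<forall>A B. A \<subseteq> B \<and> B \<subseteq> V \<longrightarrow> I A \<le> I B) \<and>
     (\<forall>A B. A \<subseteq> V \<and> B \<subseteq> V \<longrightarrow> I (A \<union> B) + I (A \<inter> B) \<le> I A + I B)"

definition thr_space :: "'v set \<Rightarrow> ('v \<Rightarrow> real) measure" where
  "thr_space V = PiM V (\<lambda>_. uniform_measure lborel {0..1})"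

fun run :: "('v \<Rightarrow> real \<Rightarrow> real) \<Rightarrow> 'v policy \<Rightarrow> ('v \<Rightarrow> real) \<Rightarrow> nat \<Rightarrow> 'v hist" where
  "run p \<pi> \<sigma> 0 = []"
| "run p \<pi> \<sigma> (Suc n) = (let h = run p \<pi> \<sigma> n in
      case \<pi> h of None \<Rightarrow> h | Some (v, c) \<Rightarrow> h @ [(v, c, \<sigma> v \<le> p v c)])"

definition accepted :: "('v \<Rightarrow> real \<Rightarrow> real) \<Rightarrow> 'v policy \<Rightarrow> ('v \<Rightarrow> real) \<Rightarrow> 'v set" where
  "accepted p \<pi> \<sigma> = {v. \<exists>n c. (v, c, True) \<in> set (run p \<pi> \<sigma> n)}"

definition utility_det :: "'v set \<Rightarrow> ('v \<Rightarrow> real \<Rightarrow> real) \<Rightarrow> ('v set \<Rightarrow> real) \<Rightarrow> 'v policy \<Rightarrow> real" where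
  "utility_det V p I \<pi> = (\<integral>\<sigma>. I (accepted p \<pi> \<sigma>) \<partial>thr_space V)"

definition probes :: "'v \<Rightarrow> 'v hist \<Rightarrow> nat" where
  "probes v h = length (filter (\<lambda>e. fst e = v) h)"

definition paid :: "'v hist \<Rightarrow> real" where
  "paid h = sum_list (map (\<lambda>(v, c, a). if a then c else 0) h)"

definition feasible_det :: "'v set \<Rightarrow> real set \<Rightarrow> ('v \<Rightarrow> real \<Rightarrow> real) \<Rightarrow> nat \<Rightarrow> real \<Rightarrow> 'v policy \<Rightarrow> bool" where
  "feasible_det V C p K B \<pi> \<longleftrightarrow>
     (AE \<sigma> in thr_space V. \<forall>n. let h = run p \<pi> \<sigma> n in
        (\<forall>(v, c, a) \<in> set h. v \<in> V \<and> c \<in> C) \<and> (\<forall>v. probes v h \<le> K) \<and> paid h \<le> B)"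

definition feasible :: "'v set \<Rightarrow> real set \<Rightarrow> ('v \<Rightarrow> real \<Rightarrow> real) \<Rightarrow> nat \<Rightarrow> real \<Rightarrow> 'v policy pmf \<Rightarrow> bool" where
  "feasible V C p K B P \<longleftrightarrow> (\<forall>\<pi> \<in> set_pmf P. feasible_det V C p K B \<pi>)"

definition utility :: "'v set \<Rightarrow> ('v \<Rightarrow> real \<Rightarrow> real) \<Rightarrow> ('v set \<Rightarrow> real) \<Rightarrow> 'v policy pmf \<Rightarrow> real" where
  "utility V p I P = measure_pmf.expectation P (utility_det V p I)"

definition OPT :: "'v set \<Rightarrow> real set \<Rightarrow> ('v \<Rightarrow> real \<Rightarrow> real) \<Rightarrow> ('v set \<Rightarrow> real) \<Rightarrow> nat \<Rightarrow> real \<Rightarrow> real" where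
  "OPT V C p I K B = Sup (utility V p I ` {P. feasible V C p K B P})"

definition small_coupons :: "real set \<Rightarrow> real \<Rightarrow> real set" where
  "small_coupons C B = {c \<in> C. c \<le> B / 2}"

definition Psi :: "real set \<Rightarrow> nat \<Rightarrow> real \<Rightarrow> real list set" where
  "Psi C K B = {\<psi> \<in> set (List.subseqs (sorted_list_of_set (small_coupons C B))). length \<psi> \<le> K}"

definition Actions :: "'v set \<Rightarrow> real set \<Rightarrow> nat \<Rightarrow> real \<Rightarrow> ('v \<times> real list) set" where
  "Actions V C K B = V \<times> Psi C K B"

definition pay :: "('v \<Rightarrow> real \<Rightarrow> real) \<Rightarrow> 'v \<Rightarrow> real list \<Rightarrow> real \<Rightarrow> real" where
  "pay p v \<psi> s = (case find (\<lambda>c. s \<le> p v c) \<psi> of None \<Rightarrow> 0 | Some c \<Rightarrow> c)"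

definition bcost :: "('v \<Rightarrow> real \<Rightarrow> real) \<Rightarrow> 'v \<Rightarrow> real list \<Rightarrow> real" where
  "bcost p v \<psi> = (\<integral>s. pay p v \<psi> s \<partial>uniform_measure lborel {0..1})"

definition fset :: "'v set \<Rightarrow> ('v \<Rightarrow> real \<Rightarrow> real) \<Rightarrow> ('v set \<Rightarrow> real) \<Rightarrow> ('v \<times> real list) set \<Rightarrow> real" where
  "fset V p I A = (\<integral>\<sigma>. I {v \<in> V. \<exists>\<psi>. (v, \<psi>) \<in> A \<and> (\<exists>c \<in> set \<psi>. \<sigma> v \<le> p v c)} \<partial>thr_space V)"

definition sample :: "'s set \<Rightarrow> ('s \<Rightarrow> real) \<Rightarrow> 's set pmf" where
  "sample S y = map_pmf (\<lambda>b. {s \<in> S. b s}) (Pi_pmf S False (\<lambda>s. bernoulli_pmf (y s)))"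

definition omega :: "'v set \<Rightarrow> real set \<Rightarrow> ('v \<Rightarrow> real \<Rightarrow> real) \<Rightarrow> ('v set \<Rightarrow> real) \<Rightarrow> nat \<Rightarrow> real
                      \<Rightarrow> ('v \<times> real list \<Rightarrow> real) \<Rightarrow> ('v \<times> real list) \<Rightarrow> real" where
  "omega V C p I K B y s =
     measure_pmf.expectation (sample (Actions V C K B) y) (\<lambda>R. fset V p I (R \<union> {s}))
     - measure_pmf.expectation (sample (Actions V C K B) y) (fset V p I)"

definition lp_feasible :: "'v set \<Rightarrow> real set \<Rightarrow> ('v \<Rightarrow> real \<Rightarrow> real) \<Rightarrow> nat \<Rightarrow> real \<Rightarrow> real
                            \<Rightarrow> ('v \<times> real list \<Rightarrow> real) \<Rightarrow> bool" where
  "lp_feasible V C p K B \<beta> z \<longleftrightarrow>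
     (\<forall>s \<in> Actions V C K B. 0 \<le> z s \<and> z s \<le> 1) \<and>
     (\<forall>v \<in> V. (\<Sum>\<psi> \<in> Psi C K B. z (v, \<psi>)) \<le> 1) \<and>
     (\<Sum>s \<in> Actions V C K B. z s * bcost p (fst s) (snd s)) \<le> \<beta> * B"

definition lp_optimal :: "'v set \<Rightarrow> real set \<Rightarrow> ('v \<Rightarrow> real \<Rightarrow> real) \<Rightarrow> nat \<Rightarrow> real \<Rightarrow> real
                           \<Rightarrow> ('v \<times> real list \<Rightarrow> real) \<Rightarrow> ('v \<times> real list \<Rightarrow> real) \<Rightarrow> bool" where
  "lp_optimal V C p K B \<beta> w z \<longleftrightarrow> lp_feasible V C p K B \<beta> z \<and>
     (\<forall>z'. lp_feasible V C p K B \<beta> z' \<longrightarrow>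
        (\<Sum>s \<in> Actions V C K B. w s * z' s) \<le> (\<Sum>s \<in> Actions V C K B. w s * z s))"

text \<open>Number of iterations of the continuous greedy loop: t = k*delta < 1 with
  delta = 1/N^2, N = |V| |Psi|, i.e. k = 0, ..., N^2 - 1.\<close>
definition greedy_steps :: "'v set \<Rightarrow> real set \<Rightarrow> nat \<Rightarrow> real \<Rightarrow> nat" where
  "greedy_steps V C K B = (card V * card (Psi C K B))\<^sup>2"

definition greedy_delta :: "'v set \<Rightarrow> real set \<Rightarrow> nat \<Rightarrow> real \<Rightarrow> real" where
  "greedy_delta V C K B = 1 / real ((card V * card (Psi C K B))\<^sup>2)"

text \<open>ys k = y(k delta); any choice of optimal LP solutions is allowed.\<close>
definition continuous_greedy_run :: "'v set \<Rightarrow> real set \<Rightarrow> ('v \<Rightarrow> real \<Rightarrow> real) \<Rightarrow> ('v set \<Rightarrow> real)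
      \<Rightarrow> nat \<Rightarrow> real \<Rightarrow> real \<Rightarrow> (nat \<Rightarrow> 'v \<times> real list \<Rightarrow> real) \<Rightarrow> bool" where
  "continuous_greedy_run V C p I K B \<beta> ys \<longleftrightarrow>
     ys 0 = (\<lambda>_. 0) \<and>
     (\<forall>k < greedy_steps V C K B. \<exists>z. lp_optimal V C p K B \<beta> (omega V C p I K B (ys k)) z \<and>
         ys (Suc k) = (\<lambda>s. ys k s + greedy_delta V C K B * z s))"

definition greedy_output :: "'v set \<Rightarrow> real set \<Rightarrow> nat \<Rightarrow> real \<Rightarrow> (nat \<Rightarrow> 'v \<times> real list \<Rightarrow> real)
      \<Rightarrow> ('v \<times> real list \<Rightarrow> real)" where
  "greedy_output V C K B ys = ys (greedy_steps V C K B)"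

subsection \<open>Contention resolution schemes (Vondrak-Chekuri-Zenklusen) for the partition matroid
  "at most one action per user"\<close>

definition partition_polytope :: "'v set \<Rightarrow> 'a set \<Rightarrow> ('v \<times> 'a \<Rightarrow> real) set" where
  "partition_polytope V Q = {x. (\<forall>s \<in> V \<times> Q. 0 \<le> x s \<and> x s \<le> 1) \<and> (\<forall>v \<in> V. (\<Sum>q \<in> Q. x (v, q)) \<le> 1)}"

definition one_per_user :: "('v \<times> 'a) set \<Rightarrow> bool" where
  "one_per_user Z \<longleftrightarrow> (\<forall>v a a'. (v, a) \<in> Z \<and> (v, a') \<in> Z \<longrightarrow> a = a')"

definition is_CRS :: "'v set \<Rightarrow> 'a set \<Rightarrow> (('v \<times> 'a \<Rightarrow> real) \<Rightarrow> ('v \<times> 'a) set \<Rightarrow> ('v \<times> 'a) set pmf) \<Rightarrow> bool" where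
  "is_CRS V Q crs \<longleftrightarrow> (\<forall>x \<in> partition_polytope V Q. \<forall>A. A \<subseteq> V \<times> Q \<longrightarrow>
      (\<forall>Z \<in> set_pmf (crs x A). Z \<subseteq> A \<inter> {s. x s > 0} \<and> one_per_user Z))"

text \<open>c-balanced: Pr[i in crs_x(R(x)) | i in R(x)] >= c, written without division as
  Pr[i in crs_x(R(x))] >= c * x_i (note crs_x(A) is a subset of A, and Pr[i in R(x)] = x_i).\<close>
definition CRS_balanced :: "'v set \<Rightarrow> 'a set \<Rightarrow> (('v \<times> 'a \<Rightarrow> real) \<Rightarrow> ('v \<times> 'a) set \<Rightarrow> ('v \<times> 'a) set pmf) \<Rightarrow> real \<Rightarrow> bool" where
  "CRS_balanced V Q crs c \<longleftrightarrow> (\<forall>x \<in> partition_polytope V Q. \<forall>i \<in> V \<times> Q. x i > 0 \<longrightarrow>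
      measure_pmf.prob (bind_pmf (sample (V \<times> Q) x) (crs x)) {Z. i \<in> Z} \<ge> c * x i)"

definition CRS_monotone :: "'v set \<Rightarrow> 'a set \<Rightarrow> (('v \<times> 'a \<Rightarrow> real) \<Rightarrow> ('v \<times> 'a) set \<Rightarrow> ('v \<times> 'a) set pmf) \<Rightarrow> bool" where
  "CRS_monotone V Q crs \<longleftrightarrow> (\<forall>x \<in> partition_polytope V Q. \<forall>i A A'.
      i \<in> A \<and> A \<subseteq> A' \<and> A' \<subseteq> V \<times> Q \<longrightarrow>
      measure_pmf.prob (crs x A) {Z. i \<in> Z} \<ge> measure_pmf.prob (crs x A') {Z. i \<in> Z})"

text \<open>seqpol B b L h: next probe when the actions L remain to be considered, b is the
  remaining budget, and h is the part of the history not yet accounted for.\<close>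
fun seqpol :: "real \<Rightarrow> real \<Rightarrow> ('v \<times> real list) list \<Rightarrow> 'v hist \<Rightarrow> ('v \<times> real) option" where
  "seqpol B b [] h = None"
| "seqpol B b ((v, \<psi>) # L) h =
     (if b < B / 2 then seqpol B b L h
      else (case \<psi> of
              [] \<Rightarrow> seqpol B b L h
            | c # \<psi>' \<Rightarrow> (case h of
                 [] \<Rightarrow> Some (v, c)
               | e # h' \<Rightarrow> (if snd (snd e) then seqpol B (b - c) L h'
                           else seqpol B b ((v, \<psi>') # L) h'))))"

definition valid_order :: "('s set \<Rightarrow> 's list) \<Rightarrow> 's set \<Rightarrow> bool" where
  "valid_order ord S \<longleftrightarrow> (\<forall>Z. Z \<subseteq> S \<longrightarrow> distinct (ord Z) \<and> set (ord Z) = Z)"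

definition alg1 :: "real \<Rightarrow> ('v \<times> real list) set \<Rightarrow> ('v \<times> real list \<Rightarrow> real)
     \<Rightarrow> (('v \<times> real list \<Rightarrow> real) \<Rightarrow> ('v \<times> real list) set \<Rightarrow> ('v \<times> real list) set pmf)
     \<Rightarrow> (('v \<times> real list) set \<Rightarrow> ('v \<times> real list) list) \<Rightarrow> 'v policy pmf" where
  "alg1 B S yg crs ord = map_pmf (\<lambda>Z. seqpol B B (ord Z)) (bind_pmf (sample S yg) (crs yg))"

definition alg2 :: "'v list \<Rightarrow> real \<Rightarrow> 'v policy" where
  "alg2 us c h = (if (\<exists>e \<in> set h. snd (snd e)) then None
                  else if length h < length us then Some (us ! length h, c) else None)"

definition valid_alg2_order :: "'v set \<Rightarrow> ('v set \<Rightarrow> real) \<Rightarrow> 'v list \<Rightarrow> bool" where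
  "valid_alg2_order V I us \<longleftrightarrow> distinct us \<and> set us = V \<and> sorted_wrt (\<lambda>a b. I {b} \<le> I {a}) us"

definition stoch_CP :: "'v policy pmf \<Rightarrow> 'v policy \<Rightarrow> 'v policy pmf" where
  "stoch_CP P1 \<pi>2 = bind_pmf (bernoulli_pmf (1/2)) (\<lambda>b. if b then P1 else return_pmf \<pi>2)"

end

theory Submission
  imports Defs
begin

text \<open>Thresholds are first rounded to the finitely many attractiveness values, so that all
  expectations are finite sums over a product distribution.

  For a feasible policy and a user v, rerun the policy with the most reluctant threshold of v; the
  small coupons (at most B/2) offered to v then form a set that depends only on the other
  thresholds. Its distribution is an LP solution of cost at most B, and v accepts one of these
  coupons whenever the first coupon she accepts is small. At most one coupon larger than B/2 can
  be redeemed, so the users who first accept a large coupon contribute at most what ALG II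
  collects. With O the value of the small part and F the multilinear extension, this LP solution
  has gain at least O - 2 F(y) at every y. Scaling it by \<open>\<beta>\<close> makes it feasible for the LP of the
  algorithm, so continuous greedy satisfies F' \<open>\<ge>\<close> \<open>\<beta>\<close> (O - 2 F) and ends above
  (1 - exp (-2 \<open>\<beta>\<close>)) / 2 O \<open>\<ge>\<close> \<open>\<beta>\<close> (1 - \<open>\<beta>\<close>) O, up to a discretisation loss of at most
  a 1/|V| fraction; since O is at most |V| times the value of ALG II, ALG II pays for this loss.

  For the rounding, write the value as a sum of marginals along a fixed order of the actions. The
  survival probability of an action, its marginal, and the lower bound 1 - (2/B) cost(R) on its
  execution are all decreasing in the sampled set R, so Harris' inequality decouples them; this yields the factors 1 - 1/e and 1 - 2 \<open>\<beta>\<close>.\<close>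

subsection \<open>Expectations over finitely supported distributions\<close>

text \<open>The obstacle is that one threshold governs all answers of a user, so neither a policy
  nor the continuous greedy procedure sees independent actions. It appears three times. A policy may
  choose offers to a user from her earlier answers; rerunning it with her largest threshold
  separates the offers from her own threshold, which makes acceptance probability and expected
  payment factor as the LP requires. In the greedy comparison it turns the usual gap O - F into O -
  2 F; the resulting rate (1 - exp (-2 \<beta>)) / 2 is still at least \<beta> (1 - \<beta>), which
  is the origin of the factor 1 - \<beta> in the guarantee. In the rounding it correlates payments
  with marginals, and the order of the actions is chosen to make this correlation favourable.

  The factor 1 - 1/e is the balance of the contention resolution scheme. The factor 1 - 2 \<beta> is
  Markov's inequality: expected payments are at most \<beta> B, and an action is discarded only
  after more than B / 2 has been paid. The final division by 2 is the coin flip between the two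
  algorithms.\<close>

abbreviation expect :: "'a pmf \<Rightarrow> ('a \<Rightarrow> real) \<Rightarrow> real" where
  "expect M f \<equiv> measure_pmf.expectation M f"

lemma expect_finite:
  "finite (set_pmf M) \<Longrightarrow> expect M f = (\<Sum>x\<in>set_pmf M. pmf M x * f x)"
  by (subst integral_measure_pmf[of "set_pmf M"]) auto

lemma expect_cong:
  assumes "\<And>x. x \<in> set_pmf M \<Longrightarrow> f x = g x"
  shows "expect M f = expect M g"
  using assms by (intro integral_cong_AE) (auto simp: AE_measure_pmf_iff)

lemma expect_mono:
  assumes "finite (set_pmf M)" "\<And>x. x \<in> set_pmf M \<Longrightarrow> f x \<le> g x"
  shows "expect M f \<le> expect M g"
  using assms by (simp add: expect_finite sum_mono mult_left_mono)

lemma expect_nonneg: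
  assumes "\<And>x. x \<in> set_pmf M \<Longrightarrow> 0 \<le> f x"
  shows "0 \<le> expect M f"
  using assms by (intro integral_nonneg_AE) (auto simp: AE_measure_pmf_iff)

lemma expect_add:
  "finite (set_pmf M) \<Longrightarrow> expect M (\<lambda>x. f x + g x) = expect M f + expect M g"
  by (simp add: integrable_measure_pmf_finite)

lemma expect_diff:
  "finite (set_pmf M) \<Longrightarrow> expect M (\<lambda>x. f x - g x) = expect M f - expect M g"
  by (simp add: integrable_measure_pmf_finite)

lemma expect_sum:
  "finite (set_pmf M) \<Longrightarrow> expect M (\<lambda>x. \<Sum>i\<in>A. f i x) = (\<Sum>i\<in>A. expect M (f i))"
  by (simp add: integrable_measure_pmf_finite)

lemma expect_swap:
  assumes "finite (set_pmf M)" "finite (set_pmf N)"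
  shows "expect M (\<lambda>x. expect N (\<lambda>y. f x y)) = expect N (\<lambda>y. expect M (\<lambda>x. f x y))"
proof -
  have "(\<Sum>x\<in>set_pmf M. \<Sum>y\<in>set_pmf N. pmf M x * (pmf N y * f x y))
      = (\<Sum>y\<in>set_pmf N. \<Sum>x\<in>set_pmf M. pmf N y * (pmf M x * f x y))"
    by (subst sum.swap) (simp add: mult.left_commute)
  then show ?thesis using assms by (simp add: expect_finite sum_distrib_left)
qed

lemma expect_bind:
  assumes "finite (set_pmf M)" "\<And>x. x \<in> set_pmf M \<Longrightarrow> finite (set_pmf (N x))"
  shows "expect (bind_pmf M N) f = expect M (\<lambda>x. expect (N x) f)"
  using assms by (subst pmf_expectation_bind[of "set_pmf M"]) (auto simp: expect_finite)

lemma finite_set_Pi_pmf: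
  assumes "finite V" "\<And>v. v \<in> V \<Longrightarrow> finite (set_pmf (D v))"
  shows "finite (set_pmf (Pi_pmf V d D))"
  using assms by (auto simp: set_Pi_pmf)

text \<open>Independence of the coordinates, in the form used for all later decoupling:
  \<open>t v\<close> is overwritten by a fresh draw while the old value stays in place, so that no
  change of index set is needed.\<close>

lemma expect_Pi_pmf_resample:
  assumes "finite V" "\<And>v. v \<in> V \<Longrightarrow> finite (set_pmf (D v))" "v \<in> V"
  shows "expect (Pi_pmf V d D) h = expect (Pi_pmf V d D) (\<lambda>t. expect (D v) (\<lambda>s. h (t(v := s))))"
proof -
  define W where "W = V - {v}"
  have W: "V = insert v W" "v \<notin> W" "finite W" using assms by (auto simp: W_def)
  have fin: "finite (set_pmf (D v))" "finite (set_pmf (Pi_pmf W d D))"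
    using assms finite_set_Pi_pmf[of W D d] by (auto simp: W_def)
  have *: "expect (Pi_pmf V d D) g
      = expect (D v) (\<lambda>s. expect (Pi_pmf W d D) (\<lambda>t. g (t(v := s))))" for g :: "_ \<Rightarrow> real"
    unfolding W(1) using W(2,3) fin
    by (simp add: Pi_pmf_insert' expect_bind)
  show ?thesis
    unfolding * by (simp) (rule expect_swap[OF fin])
qed

subsection \<open>Independent random subsets\<close>

lemma set_sample: "set_pmf (sample S y) \<subseteq> Pow S"
  by (auto simp: sample_def)

lemma finite_set_sample: "finite S \<Longrightarrow> finite (set_pmf (sample S y))"
  by (rule finite_subset[OF set_sample]) simp

lemma expect_sample_empty: "expect (sample {} y) g = g {}"
  by (simp add: sample_def)

lemma expect_sample_insert:
  assumes "finite S" "s \<notin> S" "0 \<le> y s" "y s \<le> 1"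
  shows "expect (sample (insert s S) y) g
    = y s * expect (sample S y) (\<lambda>R. g (insert s R)) + (1 - y s) * expect (sample S y) g"
proof -
  define P where "P = Pi_pmf S False (\<lambda>s. bernoulli_pmf (y s))"
  have fin: "finite (set_pmf P)"
    unfolding P_def using assms(1) by (intro finite_set_Pi_pmf) (auto intro: finite_subset[of _ UNIV])
  have fb: "finite (set_pmf (bernoulli_pmf (y s)))" by (auto intro: finite_subset[of _ UNIV])
  have e: "{t \<in> insert s S. (f(s := b)) t} = (if b then insert s {t \<in> S. f t} else {t \<in> S. f t})" for f b
    using assms(2) by auto
  have "expect (sample (insert s S) y) g
     = expect (bernoulli_pmf (y s)) (\<lambda>b. expect P (\<lambda>f. g (if b then insert s {t \<in> S. f t} else {t \<in> S. f t})))"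
    unfolding sample_def using assms(1,2) fin fb
    by (simp add: Pi_pmf_insert' expect_bind P_def[symmetric] e[symmetric] del: fun_upd_apply)
  also have "\<dots> = y s * expect P (\<lambda>f. g (insert s {t \<in> S. f t})) + (1 - y s) * expect P (\<lambda>f. g {t \<in> S. f t})"
    using assms(3,4) by simp
  finally show ?thesis by (simp add: sample_def P_def)
qed

lemma expect_sample_cong:
  assumes "\<And>R. R \<subseteq> S \<Longrightarrow> f R = g R"
  shows "expect (sample S y) f = expect (sample S y) g"
  using assms set_sample[of S y] by (intro expect_cong) auto

lemma expect_sample_mono:
  assumes "finite S" "\<And>R. R \<subseteq> S \<Longrightarrow> f R \<le> g R"
  shows "expect (sample S y) f \<le> expect (sample S y) g"
  using assms set_sample[of S y] by (intro expect_mono finite_set_sample) auto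

text \<open>A union of two independent samples is again an independent sample, missing
  \<open>s\<close> with probability (1 - y s)(1 - d s). This turns a greedy step into the addition
  of an independent sparse sample.\<close>

lemma expect_sample_Un:
  assumes "finite S" "\<And>s. s \<in> S \<Longrightarrow> 0 \<le> y s \<and> y s \<le> 1 \<and> 0 \<le> d s \<and> d s \<le> 1"
  shows "expect (sample S y) (\<lambda>R. expect (sample S d) (\<lambda>D. g (R \<union> D)))
     = expect (sample S (\<lambda>s. y s + d s - y s * d s)) g"
  using assms
proof (induction S arbitrary: g rule: finite_induct)
  case empty
  then show ?case by (simp add: expect_sample_empty)
next
  case (insert s S)
  let ?u = "\<lambda>s. y s + d s - y s * d s"
  have b: "0 \<le> y s" "y s \<le> 1" "0 \<le> d s" "d s \<le> 1" using insert.prems by auto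
  have "0 \<le> (1 - y s) * (1 - d s)" "(1 - y s) * (1 - d s) \<le> 1" 
    using b by (simp_all add: mult_le_one)
  then have u: "0 \<le> ?u s" "?u s \<le> 1" by (simp_all add: algebra_simps)
  let ?F = "\<lambda>g. expect (sample S y) (\<lambda>R. expect (sample S d) (\<lambda>D. g (R \<union> D)))"
  have fin: "finite (set_pmf (sample S w))" for w :: "'a \<Rightarrow> real" using insert.hyps by (simp add: finite_set_sample)
  have IH: "?F g = expect (sample S ?u) g" for g using insert by simp
  have "expect (sample (insert s S) y) (\<lambda>R. expect (sample (insert s S) d) (\<lambda>D. g (R \<union> D)))
    = y s * ?F (\<lambda>R. g (insert s R)) + (1 - y s) * (d s * ?F (\<lambda>R. g (insert s R)) + (1 - d s) * ?F g)"
    using b insert.hyps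
    by (simp add: expect_sample_insert expect_add[OF fin]) (simp add: algebra_simps)
  also have "\<dots> = ?u s * ?F (\<lambda>R. g (insert s R)) + (1 - ?u s) * ?F g"
    by (simp add: algebra_simps)
  also have "\<dots> = expect (sample (insert s S) ?u) g"
    by (subst expect_sample_insert) (use u insert.hyps in \<open>simp_all add: IH[of g] IH[of "\<lambda>R. g (insert s R)"]\<close>)
  finally show ?case .
qed

lemma expect_sample_prob_mono:
  assumes "finite S" "\<And>s. s \<in> S \<Longrightarrow> 0 \<le> y s \<and> y s \<le> y' s \<and> y' s \<le> 1"
    and "\<And>A A'. A \<subseteq> A' \<Longrightarrow> A' \<subseteq> S \<Longrightarrow> g A \<le> (g A' :: real)"
  shows "expect (sample S y) g \<le> expect (sample S y') g"
  using assms
proof (induction S arbitrary: g rule: finite_induct)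
  case empty
  then show ?case by (simp add: expect_sample_empty)
next
  case (insert s S)
  let ?E = "\<lambda>y g. expect (sample S y) g"
  have b: "0 \<le> y s" "y s \<le> y' s" "y' s \<le> 1" using insert.prems by auto
  have 1: "?E y g \<le> ?E y' g"
    using insert.prems(1) by (intro insert.IH insert.prems(2)) auto
  have 2: "?E y (\<lambda>R. g (insert s R)) \<le> ?E y' (\<lambda>R. g (insert s R))"
    using insert.prems(1) by (intro insert.IH insert.prems(2)) auto
  have 3: "?E y' g \<le> ?E y' (\<lambda>R. g (insert s R))"
    using insert.hyps by (intro expect_sample_mono insert.prems(2)) auto
  have "y s * ?E y (\<lambda>R. g (insert s R)) + (1 - y s) * ?E y g
     \<le> y s * ?E y' (\<lambda>R. g (insert s R)) + (1 - y s) * ?E y' g"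
    using 1 2 b by (intro add_mono mult_left_mono) auto
  also have "\<dots> = ?E y' g + y s * (?E y' (\<lambda>R. g (insert s R)) - ?E y' g)" by (simp add: algebra_simps)
  also have "\<dots> \<le> ?E y' g + y' s * (?E y' (\<lambda>R. g (insert s R)) - ?E y' g)"
    using b 3 by (intro add_left_mono mult_right_mono) auto
  also have "\<dots> = y' s * ?E y' (\<lambda>R. g (insert s R)) + (1 - y' s) * ?E y' g" by (simp add: algebra_simps)
  finally show ?case using insert.hyps b by (simp add: expect_sample_insert)
qed

text \<open>The events that the sample equals \<open>{s}\<close> are disjoint, and by a union bound
  each has probability at least \<open>d s\<close> times one minus the total of \<open>d\<close>.
  The induction conditions on the new element and uses (1 - d s)(1 - D) \<ge> 1 - (d s + D).\<close>

lemma expect_sample_ge_singletons: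
  assumes "finite S" "\<And>s. s \<in> S \<Longrightarrow> 0 \<le> d s" "(\<Sum>s\<in>S. d s) \<le> 1"
    and "\<And>A A'. A \<subseteq> A' \<Longrightarrow> A' \<subseteq> S \<Longrightarrow> h A \<le> (h A' :: real)" "0 \<le> h {}"
  shows "(1 - (\<Sum>s\<in>S. d s)) * (\<Sum>s\<in>S. d s * h {s}) \<le> expect (sample S d) h"
  using assms
proof (induction S rule: finite_induct)
  case empty
  then show ?case by (simp add: expect_sample_empty)
next
  case (insert s S)
  let ?D = "\<Sum>s\<in>S. d s" and ?H = "\<Sum>s\<in>S. d s * h {s}"
  have hp: "0 \<le> h {x}" if "x \<in> insert s S" for x using insert.prems(3)[of "{}" "{x}"] insert.prems(4) that by auto
  have D0: "0 \<le> ?D" using insert.prems by (simp add: sum_nonneg)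
  have H0: "0 \<le> ?H" using insert.prems(1) hp by (auto intro!: sum_nonneg)
  have ds: "0 \<le> d s" "d s \<le> 1" "d s + ?D \<le> 1" using insert D0 by auto
  then have D1: "?D \<le> 1" by linarith
  have IH: "(1 - ?D) * ?H \<le> expect (sample S d) h"
    using insert.prems(1,4) D1 by (intro insert.IH insert.prems(3)) auto
  have "h {s} = expect (sample S d) (\<lambda>_. h {s})" by simp
  also have "\<dots> \<le> expect (sample S d) (\<lambda>R. h (insert s R))"
    using insert.hyps by (intro expect_sample_mono insert.prems) auto
  finally have 1: "h {s} \<le> expect (sample S d) (\<lambda>R. h (insert s R))" .
  have "(1 - (d s + ?D)) * (d s * h {s} + ?H) = (1 - (d s + ?D)) * (d s * h {s}) + (1 - (d s + ?D)) * ?H"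
    by (simp add: algebra_simps)
  also have "\<dots> \<le> 1 * (d s * h {s}) + ((1 - d s) * (1 - ?D)) * ?H"
    using ds D0 H0 hp[of s] by (intro add_mono mult_right_mono) (auto simp: algebra_simps)
  also have "\<dots> = d s * h {s} + (1 - d s) * ((1 - ?D) * ?H)" by simp
  also have "\<dots> \<le> d s * expect (sample S d) (\<lambda>R. h (insert s R)) + (1 - d s) * expect (sample S d) h"
    using 1 IH ds by (intro add_mono mult_left_mono) auto
  finally show ?case using insert.hyps ds by (simp add: expect_sample_insert)
qed

text \<open>Condition on one element: the two conditional means of \<open>f\<close> and those of
  \<open>g\<close> are ordered the same way, so the covariance due to this element is
  nonnegative.\<close>

lemma Harris_antimono:
  assumes "finite S" "\<And>s. s \<in> S \<Longrightarrow> 0 \<le> y s \<and> y s \<le> 1"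
    and "\<And>A A'. A \<subseteq> A' \<Longrightarrow> A' \<subseteq> S \<Longrightarrow> f A' \<le> (f A :: real)"
    and "\<And>A A'. A \<subseteq> A' \<Longrightarrow> A' \<subseteq> S \<Longrightarrow> g A' \<le> (g A :: real)"
  shows "expect (sample S y) f * expect (sample S y) g \<le> expect (sample S y) (\<lambda>R. f R * g R)"
  using assms
proof (induction S arbitrary: f g rule: finite_induct)
  case empty
  then show ?case by (simp add: expect_sample_empty)
next
  case (insert s S)
  let ?E = "\<lambda>g. expect (sample S y) g"
  have b: "0 \<le> y s" "y s \<le> 1" using insert.prems by auto
  define F0 F1 G0 G1 where d: "F0 = ?E f" "F1 = ?E (\<lambda>R. f (insert s R))" "G0 = ?E g" "G1 = ?E (\<lambda>R. g (insert s R))"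
  have 0: "F0 * G0 \<le> ?E (\<lambda>R. f R * g R)" unfolding d
    using insert.prems(1) by (intro insert.IH insert.prems(2,3)) auto
  have 1: "F1 * G1 \<le> ?E (\<lambda>R. f (insert s R) * g (insert s R))" unfolding d
    using insert.prems(1) by (intro insert.IH insert.prems(2,3)) auto
  have 2: "F1 \<le> F0" "G1 \<le> G0"
    unfolding d using insert.hyps by (auto intro!: expect_sample_mono insert.prems(2,3))
  have "0 \<le> y s * (1 - y s) * ((F0 - F1) * (G0 - G1))"
    using 2 b by (intro mult_nonneg_nonneg) auto
  then have "(y s * F1 + (1 - y s) * F0) * (y s * G1 + (1 - y s) * G0)
      \<le> y s * (F1 * G1) + (1 - y s) * (F0 * G0)"
    by (simp add: algebra_simps power2_eq_square)
  also have "\<dots> \<le> y s * ?E (\<lambda>R. f (insert s R) * g (insert s R)) + (1 - y s) * ?E (\<lambda>R. f R * g R)"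
    using 0 1 b by (intro add_mono mult_left_mono) auto
  finally show ?case using insert.hyps b by (simp add: expect_sample_insert d)
qed

lemma expect_sample_indicator:
  assumes "finite S" "s \<in> S" "0 \<le> y s" "y s \<le> 1"
  shows "expect (sample S y) (\<lambda>R. of_bool (s \<in> R) * g R) = y s * expect (sample S y) (\<lambda>R. g (insert s R))"
proof -
  define T where "T = S - {s}"
  have T: "S = insert s T" "s \<notin> T" "finite T" using assms by (auto simp: T_def)
  have "expect (sample T y) (\<lambda>R. of_bool (s \<in> R) * g R) = expect (sample T y) (\<lambda>R. 0)"
    using T by (intro expect_sample_cong) auto
  then show ?thesis unfolding T(1) using T assms by (simp add: expect_sample_insert algebra_simps)
qed

subsection \<open>The coupon model with finitely many thresholds\<close>

text \<open>The law \<open>D v\<close> of a threshold is an arbitrary finitely supported pmf, so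
  every expectation is a finite sum and interchanges raise no question of measurability. The rounded
  uniform thresholds are an instance.\<close>

locale coupon_model =
  fixes V :: "'v set" and C :: "real set" and p :: "'v \<Rightarrow> real \<Rightarrow> real"
    and I :: "'v set \<Rightarrow> real" and K :: nat and B :: real and D :: "'v \<Rightarrow> real pmf"
  assumes fin_V: "finite V" and fin_C: "finite C" and C_nonneg: "\<And>c. c \<in> C \<Longrightarrow> 0 \<le> c"
    and p_mono: "\<And>v c c'. v \<in> V \<Longrightarrow> c \<in> C \<Longrightarrow> c' \<in> C \<Longrightarrow> c \<le> c' \<Longrightarrow> p v c \<le> p v c'"
    and subm: "monotone_submodular V I" and B_nonneg: "0 \<le> B"
    and fin_D: "\<And>v. finite (set_pmf (D v))"
begin

abbreviation "M \<equiv> Pi_pmf V 0 D"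
abbreviation "Q \<equiv> Psi C K B"
abbreviation "S \<equiv> Actions V C K B"

definition acc :: "'v \<times> real list \<Rightarrow> ('v \<Rightarrow> real) \<Rightarrow> bool" where
  "acc s t \<longleftrightarrow> (\<exists>c\<in>set (snd s). t (fst s) \<le> p (fst s) c)"

definition Acc :: "('v \<times> real list) set \<Rightarrow> ('v \<Rightarrow> real) \<Rightarrow> 'v set" where
  "Acc R t = {v \<in> V. \<exists>q. (v, q) \<in> R \<and> acc (v, q) t}"

definition f :: "('v \<times> real list) set \<Rightarrow> real" where
  "f R = expect M (\<lambda>t. I (Acc R t))"

definition cost :: "'v \<times> real list \<Rightarrow> real" where
  "cost s = expect (D (fst s)) (pay p (fst s) (snd s))"

definition F :: "('v \<times> real list \<Rightarrow> real) \<Rightarrow> real" where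
  "F y = expect (sample S y) f"

definition gain :: "('v \<times> real list \<Rightarrow> real) \<Rightarrow> 'v \<times> real list \<Rightarrow> real" where
  "gain y s = expect (sample S y) (\<lambda>R. f (R \<union> {s}) - f R)"

lemma fin_M: "finite (set_pmf M)"
  using fin_V fin_D by (intro finite_set_Pi_pmf) auto

lemma set_M: "t \<in> set_pmf M \<longleftrightarrow> (\<forall>v\<in>V. t v \<in> set_pmf (D v)) \<and> (\<forall>v. v \<notin> V \<longrightarrow> t v = 0)"
  using fin_V by (auto simp: set_Pi_pmf PiE_dflt_def)

lemma resample: "v \<in> V \<Longrightarrow> expect M h = expect M (\<lambda>t. expect (D v) (\<lambda>s. h (t(v := s))))"
  using fin_V fin_D by (intro expect_Pi_pmf_resample) auto

lemma fin_Q: "finite Q"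
  unfolding Psi_def by (rule finite_subset[OF _ finite_set]) blast

lemma fin_S: "finite S"
  using fin_V fin_Q by (simp add: Actions_def)

lemma Q_small: "q \<in> Q \<Longrightarrow> c \<in> set q \<Longrightarrow> c \<in> C \<and> 0 \<le> c \<and> c \<le> B / 2"
  using fin_C C_nonneg
  by (auto simp: Psi_def small_coupons_def set_subseqs_eq subseq_conv_nths dest!: in_set_nthsD)

lemma Nil_in_Q: "[] \<in> Q"
  by (auto simp: Psi_def)

lemma Acc_subset: "Acc R t \<subseteq> V"
  by (auto simp: Acc_def)

lemma Acc_mono: "R \<subseteq> R' \<Longrightarrow> Acc R t \<subseteq> Acc R' t"
  by (auto simp: Acc_def)

lemma Acc_Un: "Acc (R \<union> R') t = Acc R t \<union> Acc R' t"
  by (auto simp: Acc_def)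

lemma Acc_insert: "v \<in> V \<Longrightarrow> Acc (R \<union> {(v, q)}) t = Acc R t \<union> (if acc (v, q) t then {v} else {})"
  by (auto simp: Acc_def)

section \<open>Submodularity of the influence and of its expectation\<close>

lemma I_empty: "I {} = 0" and I_nonneg: "A \<subseteq> V \<Longrightarrow> 0 \<le> I A"
  and I_mono: "A \<subseteq> A' \<Longrightarrow> A' \<subseteq> V \<Longrightarrow> I A \<le> I A'"
  and I_subm: "A \<subseteq> V \<Longrightarrow> A' \<subseteq> V \<Longrightarrow> I (A \<union> A') + I (A \<inter> A') \<le> I A + I A'"
  using subm unfolding monotone_submodular_def by blast+

lemma I_diminishing:
  assumes "A \<subseteq> A'" "A' \<subseteq> V" "X \<subseteq> V"
  shows "I (A' \<union> X) - I A' \<le> I (A \<union> X) - I A"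
proof -
  have "I ((A \<union> X) \<union> A') + I ((A \<union> X) \<inter> A') \<le> I (A \<union> X) + I A'"
    using assms by (intro I_subm) auto
  moreover have "(A \<union> X) \<union> A' = A' \<union> X" using assms by auto
  moreover have "I A \<le> I ((A \<union> X) \<inter> A')" using assms by (intro I_mono) auto
  ultimately show ?thesis by simp
qed

lemma I_Un_le_sum:
  assumes "finite W" "W \<subseteq> V" "A \<subseteq> V"
  shows "I (A \<union> W) \<le> I A + (\<Sum>v\<in>W. I (A \<union> {v}) - I A)"
  using assms
proof (induction W rule: finite_induct)
  case (insert v W)
  have "I ((A \<union> W) \<union> {v}) - I (A \<union> W) \<le> I (A \<union> {v}) - I A"
    using insert by (intro I_diminishing) auto
  then show ?case using insert by simp
qed simp

text \<open>Build \<open>A\<close> one user at a time: by diminishing returns each user adds to the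
  current part at least what she would add as the last one, and these increments sum to
  \<open>I A\<close>.\<close>

lemma I_sum_removal:
  assumes "A \<subseteq> V"
  shows "(\<Sum>v\<in>A. I A - I (A - {v})) \<le> I A"
proof -
  have "(\<Sum>v\<in>X. I A - I (A - {v})) \<le> I X" if "finite X" "X \<subseteq> A" for X
    using that
  proof (induction X rule: finite_induct)
    case empty
    then show ?case by (simp add: I_empty)
  next
    case (insert v X)
    have "I ((A - {v}) \<union> {v}) - I (A - {v}) \<le> I (X \<union> {v}) - I X"
      using insert assms by (intro I_diminishing) auto
    moreover have "(A - {v}) \<union> {v} = A" using insert by auto
    ultimately show ?case using insert by simp
  qed
  from this[of A] show ?thesis using assms fin_V finite_subset by blast
qed

lemma f_empty: "f {} = 0"
  by (simp add: f_def Acc_def I_empty)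

lemma f_nonneg: "0 \<le> f R"
  unfolding f_def by (intro expect_nonneg I_nonneg Acc_subset)

lemma f_mono: "R \<subseteq> R' \<Longrightarrow> f R \<le> f R'"
  unfolding f_def by (intro expect_mono fin_M I_mono Acc_subset Acc_mono)

lemma f_diminishing:
  assumes "R \<subseteq> R'"
  shows "f (R' \<union> X) - f R' \<le> f (R \<union> X) - f R"
  unfolding f_def expect_diff[OF fin_M, symmetric] Acc_Un
  using assms by (intro expect_mono fin_M I_diminishing Acc_subset Acc_mono)

section \<open>The multilinear extension and one greedy step\<close>

lemma F_nonneg: "0 \<le> F y"
  unfolding F_def by (intro expect_nonneg f_nonneg)

lemma F_zero: "F (\<lambda>_. 0) = 0"
proof -
  have "expect (sample T (\<lambda>_. 0)) g = g {}" if "finite T" for T :: "('v \<times> real list) set" and g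
    using that
    by (induction T arbitrary: g rule: finite_induct) (simp_all add: expect_sample_empty expect_sample_insert)
  then show ?thesis by (simp add: F_def fin_S f_empty)
qed

text \<open>The vector y + \<delta> z dominates the probabilities of the union of a
  \<open>y\<close>-sample with an independent \<delta> z-sample, so the increase is at least the
  mean gain from the second sample, of which only singleton outcomes are counted. At most one action
  per user gives \<delta> z total mass at most \<delta> times \<open>card V\<close>, whence the
  factor.\<close>

lemma F_step:
  fixes \<delta> :: real
  assumes z: "\<And>s. s \<in> S \<Longrightarrow> 0 \<le> z s \<and> z s \<le> 1" "\<And>v. v \<in> V \<Longrightarrow> (\<Sum>q\<in>Q. z (v, q)) \<le> 1"
    and y: "\<And>s. s \<in> S \<Longrightarrow> 0 \<le> y s \<and> y s + \<delta> * z s \<le> 1"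
    and \<delta>: "0 \<le> \<delta>" "\<delta> * card V \<le> 1" "\<delta> \<le> 1"
  shows "F y + \<delta> * (1 - \<delta> * card V) * (\<Sum>s\<in>S. gain y s * z s) \<le> F (\<lambda>s. y s + \<delta> * z s)"
proof -
  let ?d = "\<lambda>s. \<delta> * z s"
  define h where "h A = expect (sample S y) (\<lambda>R. f (R \<union> A) - f R)" for A
  note fs = finite_set_sample[OF fin_S]
  have d: "0 \<le> ?d s" "?d s \<le> 1" "0 \<le> y s" "y s \<le> 1" "y s + ?d s \<le> 1" if "s \<in> S" for s
  proof -
    show "0 \<le> ?d s" "?d s \<le> 1" "0 \<le> y s" using z(1)[OF that] y[OF that] \<delta> by (auto simp: mult_le_one)
    then show "y s \<le> 1" "y s + ?d s \<le> 1" using y[OF that] by auto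
  qed
  have "(\<Sum>s\<in>S. ?d s) = \<delta> * (\<Sum>v\<in>V. \<Sum>q\<in>Q. z (v, q))"
    by (simp add: Actions_def sum.cartesian_product sum_distrib_left split_def)
  also have "\<dots> \<le> \<delta> * (\<Sum>v\<in>V. 1)"
    using \<delta> z by (intro mult_left_mono sum_mono) auto
  finally have sd: "(\<Sum>s\<in>S. ?d s) \<le> \<delta> * card V" by simp
  have hn: "0 \<le> h A" for A unfolding h_def by (intro expect_nonneg) (simp add: f_mono)
  have "\<delta> * (1 - \<delta> * card V) * (\<Sum>s\<in>S. gain y s * z s) = (1 - \<delta> * card V) * (\<Sum>s\<in>S. ?d s * h {s})"
    by (simp add: h_def gain_def sum_distrib_left algebra_simps)
  also have "\<dots> \<le> (1 - (\<Sum>s\<in>S. ?d s)) * (\<Sum>s\<in>S. ?d s * h {s})"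
    using sd d hn by (intro mult_right_mono sum_nonneg) auto
  also have "\<dots> \<le> expect (sample S ?d) h"
  proof (rule expect_sample_ge_singletons)
    show "h A \<le> h A'" if "A \<subseteq> A'" for A A'
      unfolding h_def using that by (intro expect_mono fs diff_right_mono f_mono) auto
  qed (use fin_S d sd \<delta> hn in auto)
  also have "\<dots> = expect (sample S y) (\<lambda>R. expect (sample S ?d) (\<lambda>A. f (R \<union> A))) - F y"
    unfolding h_def F_def by (subst expect_swap[OF fs fs]) (simp add: expect_diff[OF fs])
  also have "\<dots> = F (\<lambda>s. y s + ?d s - y s * ?d s) - F y"
    using d by (subst expect_sample_Un[OF fin_S]) (auto simp: F_def)
  also have "\<dots> \<le> F (\<lambda>s. y s + ?d s) - F y"
    unfolding F_def
  proof (intro diff_right_mono expect_sample_prob_mono fin_S f_mono)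
    fix s assume "s \<in> S"
    from d[OF this] have "0 \<le> y s * ?d s" "y s * ?d s \<le> y s"
      using mult_left_mono[of "?d s" 1 "y s"] by simp_all
    with d[OF \<open>s \<in> S\<close>] show "0 \<le> y s + ?d s - y s * ?d s \<and> y s + ?d s - y s * ?d s \<le> y s + ?d s \<and> y s + ?d s \<le> 1"
      by simp
  qed
  finally show ?thesis by simp
qed

section \<open>Random menus, one per user, as LP solutions\<close>

lemma sum_over_actions:
  assumes "\<And>v t. v \<in> V \<Longrightarrow> t \<in> set_pmf M \<Longrightarrow> \<psi> v t \<in> Q"
  shows "(\<Sum>s\<in>S. expect M (\<lambda>t. of_bool (\<psi> (fst s) t = snd s)) * g s) = (\<Sum>v\<in>V. expect M (\<lambda>t. g (v, \<psi> v t)))"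
proof -
  have "(\<Sum>q\<in>Q. expect M (\<lambda>t. of_bool (\<psi> v t = q)) * g (v, q)) = expect M (\<lambda>t. g (v, \<psi> v t))"
    if "v \<in> V" for v
  proof -
    have "(\<Sum>q\<in>Q. expect M (\<lambda>t. of_bool (\<psi> v t = q)) * g (v, q))
        = expect M (\<lambda>t. \<Sum>q\<in>Q. of_bool (\<psi> v t = q) * g (v, q))"
      by (simp add: expect_sum[OF fin_M])
    also have "\<dots> = expect M (\<lambda>t. g (v, \<psi> v t))"
      using assms[OF that] fin_Q by (intro expect_cong) simp
    finally show ?thesis .
  qed
  moreover have "(\<Sum>s\<in>S. expect M (\<lambda>t. of_bool (\<psi> (fst s) t = snd s)) * g s)
      = (\<Sum>v\<in>V. \<Sum>q\<in>Q. expect M (\<lambda>t. of_bool (\<psi> v t = q)) * g (v, q))"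
    by (simp add: Actions_def sum.cartesian_product split_def)
  ultimately show ?thesis by simp
qed

lemma f_marginal:
  "v \<in> V \<Longrightarrow> f (R \<union> {(v, q)}) - f R
    = expect M (\<lambda>t. I (Acc R t \<union> (if acc (v, q) t then {v} else {})) - I (Acc R t))"
  unfolding f_def by (simp only: Acc_insert expect_diff[OF fin_M, symmetric])

lemma Acc_fun_upd:
  "Acc R (t(v := r)) - {v} = Acc R t - {v}"
  by (auto simp: Acc_def acc_def)

text \<open>The factor is 2 and not 1 because one threshold drives the responses of a user both to
  \<^term>\<open>\<psi>\<close> and to \<^term>\<open>R\<close>: the marginal gain of an action omits the thresholds that
  \<^term>\<open>R\<close> already covers, and these are charged to \<^term>\<open>f R\<close> once more.\<close>
lemma comparator_bound:
  assumes \<psi>: "\<And>v t. v \<in> V \<Longrightarrow> t \<in> set_pmf M \<Longrightarrow> \<psi> v t \<in> Q"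
    and indep: "\<And>v t r. v \<in> V \<Longrightarrow> t \<in> set_pmf M \<Longrightarrow> \<psi> v (t(v := r)) = \<psi> v t"
  shows "expect M (\<lambda>t. I {v \<in> V. acc (v, \<psi> v t) t})
    \<le> 2 * f R + (\<Sum>s\<in>S. expect M (\<lambda>t. of_bool (\<psi> (fst s) t = snd s)) * (f (R \<union> {s}) - f R))"
proof -
  define U where "U t = {v \<in> V. acc (v, \<psi> v t) t}" for t
  \<comment> \<open>What \<open>v\<close> adds once her own presence in \<open>Acc R t\<close> is
    disregarded. Removing her makes \<open>\<rho> v t\<close> independent of
    \<open>t v\<close>.\<close>
  define \<rho> where "\<rho> v t = I (Acc R t \<union> {v}) - I (Acc R t - {v})" for v t
  define out where "out v = expect M (\<lambda>t. I (Acc R t) - I (Acc R t - {v}))" for v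
  define \<alpha> where "\<alpha> v q = expect (D v) (\<lambda>r. of_bool (\<exists>c\<in>set q. r \<le> p v c))" for v q
  have I1: "I A \<le> I (A \<union> {v})" "I (A - {v}) \<le> I A" if "A \<subseteq> V" "v \<in> V" for A v
    using that by (auto intro!: I_mono)
  have \<rho>0: "0 \<le> \<rho> v t" if "v \<in> V" for v t
    using I1[OF Acc_subset that, of R t] by (simp add: \<rho>_def)
  have \<rho>_upd: "\<rho> v (t(v := r)) = \<rho> v t" for v t r
  proof -
    have "Acc R (t(v := r)) \<union> {v} = Acc R t \<union> {v}" using Acc_fun_upd[of R t v r] by blast
    then show ?thesis by (simp add: \<rho>_def Acc_fun_upd)
  qed
  \<comment> \<open>The thresholds \<open>t\<close> of the comparator and \<open>t'\<close> of
    \<open>R\<close> are independent copies, so that membership of \<open>v\<close> in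
    \<open>U t\<close> and \<open>\<rho> v t'\<close> factor.\<close>
  have "expect M (\<lambda>t. I (U t)) = expect M (\<lambda>t. expect M (\<lambda>t'. I (U t)))" by simp
  also have "\<dots> \<le> expect M (\<lambda>t. expect M (\<lambda>t'. I (Acc R t') + (\<Sum>v\<in>V. of_bool (v \<in> U t) * \<rho> v t')))"
  proof (intro expect_mono fin_M)
    fix t t'
    have UV: "U t \<subseteq> V" by (auto simp: U_def)
    have "I (U t) \<le> I (Acc R t' \<union> U t)" using UV Acc_subset by (intro I_mono) auto
    also have "\<dots> \<le> I (Acc R t') + (\<Sum>v\<in>U t. I (Acc R t' \<union> {v}) - I (Acc R t'))"
      using UV fin_V finite_subset by (intro I_Un_le_sum Acc_subset) blast+
    also have "(\<Sum>v\<in>U t. I (Acc R t' \<union> {v}) - I (Acc R t')) \<le> (\<Sum>v\<in>U t. \<rho> v t')"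
      using UV I1[OF Acc_subset, of _ R t'] by (intro sum_mono) (auto simp: \<rho>_def)
    also have "(\<Sum>v\<in>U t. \<rho> v t') = (\<Sum>v\<in>V. of_bool (v \<in> U t) * \<rho> v t')"
      using UV fin_V by (simp add: sum.inter_restrict[symmetric] Int_absorb1 of_bool_def if_distrib[of "\<lambda>x. x * _"] cong: if_cong)
    finally show "I (U t) \<le> I (Acc R t') + (\<Sum>v\<in>V. of_bool (v \<in> U t) * \<rho> v t')" by simp
  qed
  also have "\<dots> = f R + (\<Sum>v\<in>V. expect M (\<lambda>t. of_bool (v \<in> U t)) * expect M (\<rho> v))"
    by (simp add: expect_add[OF fin_M] expect_sum[OF fin_M] f_def)
  also have "(\<Sum>v\<in>V. expect M (\<lambda>t. of_bool (v \<in> U t)) * expect M (\<rho> v))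
      \<le> (\<Sum>v\<in>V. expect M (\<lambda>t. f (R \<union> {(v, \<psi> v t)}) - f R) + out v)"
  proof (intro sum_mono)
    fix v assume v: "v \<in> V"
    have "expect M (\<lambda>t. of_bool (v \<in> U t)) = expect M (\<lambda>t. expect (D v) (\<lambda>r. of_bool (v \<in> U (t(v := r)))))"
      by (rule resample[OF v])
    also have "\<dots> = expect M (\<lambda>t. \<alpha> v (\<psi> v t))"
      using v indep by (intro expect_cong) (simp add: \<alpha>_def U_def acc_def)
    finally have 1: "expect M (\<lambda>t. of_bool (v \<in> U t)) = expect M (\<lambda>t. \<alpha> v (\<psi> v t))" .
    have 2: "\<alpha> v q * expect M (\<rho> v) \<le> f (R \<union> {(v, q)}) - f R + out v" for q
    proof -
      \<comment> \<open>For a fixed menu \<open>q\<close> the copies are merged again: \<rho>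
        ignores \<open>t v\<close>, so the acceptance of \<open>q\<close> can be read off the same
        thresholds.\<close>
      have "\<alpha> v q * expect M (\<rho> v) = expect M (\<lambda>t. expect (D v) (\<lambda>r. of_bool (acc (v, q) (t(v := r))) * \<rho> v (t(v := r))))"
        by (simp add: \<rho>_upd \<alpha>_def acc_def)
      also have "\<dots> = expect M (\<lambda>t. of_bool (acc (v, q) t) * \<rho> v t)"
        by (rule resample[OF v, symmetric])
      also have "\<dots> \<le> expect M (\<lambda>t. (I (Acc R t \<union> (if acc (v, q) t then {v} else {})) - I (Acc R t))
           + (I (Acc R t) - I (Acc R t - {v})))"
        using I1[OF Acc_subset v] by (intro expect_mono fin_M) (auto simp: \<rho>_def)
      also have "\<dots> = f (R \<union> {(v, q)}) - f R + out v"
        by (simp only: f_marginal[OF v] out_def expect_add[OF fin_M])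
      finally show ?thesis .
    qed
    have "expect M (\<lambda>t. of_bool (v \<in> U t)) * expect M (\<rho> v) = expect M (\<lambda>t. \<alpha> v (\<psi> v t) * expect M (\<rho> v))"
      by (simp add: 1)
    also have "\<dots> \<le> expect M (\<lambda>t. f (R \<union> {(v, \<psi> v t)}) - f R + out v)"
      by (intro expect_mono fin_M 2)
    also have "\<dots> = expect M (\<lambda>t. f (R \<union> {(v, \<psi> v t)}) - f R) + out v"
      by (subst expect_add[OF fin_M]) simp
    finally show "expect M (\<lambda>t. of_bool (v \<in> U t)) * expect M (\<rho> v)
      \<le> expect M (\<lambda>t. f (R \<union> {(v, \<psi> v t)}) - f R) + out v" .
  qed
  also have "\<dots> = (\<Sum>s\<in>S. expect M (\<lambda>t. of_bool (\<psi> (fst s) t = snd s)) * (f (R \<union> {s}) - f R)) + (\<Sum>v\<in>V. out v)"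
    by (subst sum_over_actions[OF \<psi>]) (simp_all add: sum.distrib)
  also have "(\<Sum>v\<in>V. out v) \<le> f R"
  proof -
    have "(\<Sum>v\<in>V. I (Acc R t) - I (Acc R t - {v})) \<le> I (Acc R t)" for t
    proof -
      have "(\<Sum>v\<in>V. I (Acc R t) - I (Acc R t - {v})) = (\<Sum>v\<in>Acc R t. I (Acc R t) - I (Acc R t - {v}))"
        using fin_V Acc_subset by (intro sum.mono_neutral_right) auto
      then show ?thesis using I_sum_removal[OF Acc_subset] by simp
    qed
    then show ?thesis
      unfolding out_def f_def expect_sum[OF fin_M, symmetric] by (intro expect_mono fin_M)
  qed
  finally show ?thesis by (simp add: U_def)
qed

lemma comparator_gain:
  assumes \<psi>: "\<And>v t. v \<in> V \<Longrightarrow> t \<in> set_pmf M \<Longrightarrow> \<psi> v t \<in> Q"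
    and indep: "\<And>v t r. v \<in> V \<Longrightarrow> t \<in> set_pmf M \<Longrightarrow> \<psi> v (t(v := r)) = \<psi> v t"
  shows "expect M (\<lambda>t. I {v \<in> V. acc (v, \<psi> v t) t}) - 2 * F y
    \<le> (\<Sum>s\<in>S. gain y s * expect M (\<lambda>t. of_bool (\<psi> (fst s) t = snd s)))"
proof -
  note fs = finite_set_sample[OF fin_S]
  let ?O = "expect M (\<lambda>t. I {v \<in> V. acc (v, \<psi> v t) t})"
  have "?O = expect (sample S y) (\<lambda>R. ?O)" by simp
  also have "\<dots> \<le> expect (sample S y) (\<lambda>R. 2 * f R
     + (\<Sum>s\<in>S. expect M (\<lambda>t. of_bool (\<psi> (fst s) t = snd s)) * (f (R \<union> {s}) - f R)))"
    using assms by (intro expect_mono fs comparator_bound) auto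
  also have "\<dots> = 2 * F y + (\<Sum>s\<in>S. gain y s * expect M (\<lambda>t. of_bool (\<psi> (fst s) t = snd s)))"
    by (simp add: expect_add[OF fs] expect_sum[OF fs] F_def gain_def mult.commute)
  finally show ?thesis by simp
qed

text \<open>Since \<open>\<psi> v t\<close> ignores \<open>t v\<close>, the threshold of
  \<open>v\<close> may be redrawn after her menu is fixed. The LP cost is thereby a mean over common
  thresholds, where the budget of the policy holds pointwise.\<close>

lemma comparator_cost:
  assumes \<psi>: "\<And>v t. v \<in> V \<Longrightarrow> t \<in> set_pmf M \<Longrightarrow> \<psi> v t \<in> Q"
    and indep: "\<And>v t r. v \<in> V \<Longrightarrow> t \<in> set_pmf M \<Longrightarrow> \<psi> v (t(v := r)) = \<psi> v t"
  shows "(\<Sum>s\<in>S. expect M (\<lambda>t. of_bool (\<psi> (fst s) t = snd s)) * cost s)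
    = expect M (\<lambda>t. \<Sum>v\<in>V. pay p v (\<psi> v t) (t v))"
proof -
  have "(\<Sum>s\<in>S. expect M (\<lambda>t. of_bool (\<psi> (fst s) t = snd s)) * cost s) = (\<Sum>v\<in>V. expect M (\<lambda>t. cost (v, \<psi> v t)))"
    by (rule sum_over_actions[OF \<psi>])
  also have "\<dots> = (\<Sum>v\<in>V. expect M (\<lambda>t. pay p v (\<psi> v t) (t v)))"
  proof (intro sum.cong refl)
    fix v assume v: "v \<in> V"
    have "expect M (\<lambda>t. pay p v (\<psi> v t) (t v))
      = expect M (\<lambda>t. expect (D v) (\<lambda>r. pay p v (\<psi> v (t(v := r))) ((t(v := r)) v)))"
      by (rule resample[OF v])
    also have "\<dots> = expect M (\<lambda>t. cost (v, \<psi> v t))"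
      using v indep by (intro expect_cong) (simp add: cost_def)
    finally show "expect M (\<lambda>t. cost (v, \<psi> v t)) = expect M (\<lambda>t. pay p v (\<psi> v t) (t v))" by simp
  qed
  also have "\<dots> = expect M (\<lambda>t. \<Sum>v\<in>V. pay p v (\<psi> v t) (t v))"
    by (simp add: expect_sum[OF fin_M])
  finally show ?thesis .
qed

end

subsection \<open>Runs of policies\<close>

lemma run_response: "(v, c, a) \<in> set (run p \<pi> t n) \<Longrightarrow> a = (t v \<le> p v c)"
  by (induction n) (auto simp: Let_def split: option.splits)

lemma set_run_mono: "n \<le> m \<Longrightarrow> set (run p \<pi> t n) \<subseteq> set (run p \<pi> t m)"
  by (rule lift_Suc_mono_le[of "\<lambda>n. set (run p \<pi> t n)"]) (auto simp: Let_def split: option.splits)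

text \<open>As long as \<open>v\<close> has accepted nothing at the lower threshold, the higher one
  produces the same answers and the runs coincide. Hence her first acceptance is an offer in both
  runs; afterwards they may diverge, and the second alternative merely remembers that offer.\<close>

lemma run_coupling:
  assumes t': "t v \<le> t' v" "\<And>w. w \<noteq> v \<Longrightarrow> t' w = t w"
  shows "run p \<pi> t n = run p \<pi> t' n \<and> (\<forall>c. (v, c, True) \<notin> set (run p \<pi> t n))
    \<or> (\<exists>c a. (v, c, True) \<in> set (run p \<pi> t n) \<and> (v, c, a) \<in> set (run p \<pi> t' n))"
proof (induction n)
  case (Suc n)
  then show ?case
  proof
    assume *: "run p \<pi> t n = run p \<pi> t' n \<and> (\<forall>c. (v, c, True) \<notin> set (run p \<pi> t n))"
    show ?thesis
    proof (cases "\<pi> (run p \<pi> t n)")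
      case None
      with * show ?thesis by (auto simp: Let_def)
    next
      case (Some e)
      then obtain w c where e: "\<pi> (run p \<pi> t n) = Some (w, c)" by (cases e) auto
      show ?thesis
      proof (cases "w = v")
        case True
        with e * t'(1) show ?thesis by (auto simp: Let_def)
      next
        case False
        with e * t'(2)[OF False] show ?thesis by (auto simp: Let_def)
      qed
    qed
  qed (auto simp: Let_def split: option.splits)
qed simp

text \<open>Different users use different entries of the history, so no payment is counted
  twice.\<close>

lemma sum_le_paid:
  assumes "finite X" "\<And>v. v \<in> X \<Longrightarrow> (v, c v, True) \<in> set h"
    and "\<And>v c a. (v, c, a) \<in> set h \<Longrightarrow> 0 \<le> c"
  shows "(\<Sum>v\<in>X. c v) \<le> paid h"
  using assms
proof (induction h arbitrary: X)
  case Nil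
  then have "X = {}" by auto
  then show ?case by (simp add: paid_def)
next
  case (Cons e h)
  obtain v0 c0 a0 where e: "e = (v0, c0, a0)" by (cases e)
  have c0: "0 \<le> c0" using Cons.prems(3) e by auto
  show ?case
  proof (cases "v0 \<in> X \<and> c v0 = c0 \<and> a0")
    case True
    have "(\<Sum>v\<in>X - {v0}. c v) \<le> paid h"
      using Cons.prems True e by (intro Cons.IH) auto
    with True Cons.prems(1) show ?thesis by (simp add: e paid_def sum.remove[of X v0])
  next
    case False
    have "(v, c v, True) \<in> set h" if "v \<in> X" for v
      using Cons.prems(2)[OF that] False that by (auto simp: e)
    then have "(\<Sum>v\<in>X. c v) \<le> paid h"
      using Cons.prems by (intro Cons.IH) auto
    with c0 show ?thesis by (simp add: e paid_def)
  qed
qed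

lemma pay_cases: "pay p v q s = 0 \<and> (\<forall>c\<in>set q. \<not> s \<le> p v c) \<or> pay p v q s \<in> set q \<and> s \<le> p v (pay p v q s)"
  by (induction q) (auto simp: pay_def split: if_splits)

text \<open>In a sorted list the first accepted coupon is the cheapest accepted one.\<close>

lemma pay_le:
  assumes "sorted q" "c \<in> set q" "s \<le> p v c"
  shows "pay p v q s \<le> c"
  using assms by (induction q) (auto simp: pay_def)

context coupon_model
begin

section \<open>From a feasible policy to an LP solution\<close>

lemma pay_nonneg: "q \<in> Q \<Longrightarrow> 0 \<le> pay p v q s"
  using pay_cases[of p v q s] Q_small by auto

lemma cost_nonneg: "s \<in> S \<Longrightarrow> 0 \<le> cost s"
  unfolding cost_def by (intro expect_nonneg pay_nonneg) (auto simp: Actions_def)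

text \<open>A user who accepts from her menu also accepts some coupon \<open>c\<close> in the true
  run. Either \<open>c\<close> is on her menu, and the menu is sorted, or \<open>c\<close> exceeds B
  / 2; in both cases the menu costs her at most \<open>c\<close>, so the budget of the true run
  bounds the sum of the menu payments. The set \<open>W\<close> collects the users who redeem a
  coupon above B / 2.\<close>

lemma policy_comparator:
  assumes feas: "\<And>t n. t \<in> set_pmf M \<Longrightarrow> (\<forall>(v, c, a)\<in>set (run p \<pi> t n). v \<in> V \<and> c \<in> C)
       \<and> (\<forall>v. probes v (run p \<pi> t n) \<le> K) \<and> paid (run p \<pi> t n) \<le> B"
  obtains \<psi> where "\<And>v t. v \<in> V \<Longrightarrow> t \<in> set_pmf M \<Longrightarrow> \<psi> v t \<in> Q"
    and "\<And>v t r. \<psi> v (t(v := r)) = \<psi> v t"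
    and "\<And>t. t \<in> set_pmf M \<Longrightarrow> (\<Sum>v\<in>V. pay p v (\<psi> v t) (t v)) \<le> B"
    and "\<And>t. t \<in> set_pmf M \<Longrightarrow> \<exists>W. accepted p \<pi> t \<subseteq> {v \<in> V. acc (v, \<psi> v t) t} \<union> W \<and>
           (W = {} \<or> (\<exists>v c. W = {v} \<and> v \<in> V \<and> c \<in> C \<and> t v \<le> p v c))"
proof -
  define top where "top v = Max (set_pmf (D v))" for v
  define offered where
    "offered v t = {c. \<exists>n a. (v, c, a) \<in> set (run p \<pi> (t(v := top v)) n)}" for v t
  define \<psi> where
    "\<psi> v t = filter (\<lambda>c. c \<in> offered v t) (sorted_list_of_set (small_coupons C B))" for v t
  have set_\<psi>: "set (\<psi> v t) = small_coupons C B \<inter> offered v t" for v t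
    using fin_C by (auto simp: \<psi>_def small_coupons_def)
  \<comment> \<open>The largest threshold lies in the support, so feasibility applies to the rerun
    as well; this bounds the length of the menu by \<open>K\<close>.\<close>
  have t_top: "t(v := top v) \<in> set_pmf M" "t v \<le> top v" if "v \<in> V" "t \<in> set_pmf M" for v t
    using that fin_D[of v] by (auto simp: set_M top_def set_pmf_not_empty)
  have feasD: "v \<in> V" "c \<in> C" "0 \<le> c" if "(v, c, a) \<in> set (run p \<pi> t n)" "t \<in> set_pmf M" for v c a t n
    using feas[OF that(2), of n] that(1) C_nonneg by auto
  \<comment> \<open>An acceptable coupon occurring in either run excludes the first alternative of
    the coupling.\<close>
  have first: "\<exists>c. (v, c, True) \<in> set (run p \<pi> t n) \<and> c \<in> offered v t"
    if "v \<in> V" "t \<in> set_pmf M" "t v \<le> p v c'" "(v, c', a') \<in> set (run p \<pi> t n) \<or> (v, c', a') \<in> set (run p \<pi> (t(v := top v)) n)"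
    for v t c' a' n
    using run_coupling[of t v "t(v := top v)" p \<pi> n] t_top(2)[OF that(1,2)] that(3,4)
      run_response[of v c' a' p \<pi> t n]
    by (auto simp: offered_def)
  show thesis
  proof
    show "\<psi> v (t(v := r)) = \<psi> v t" for v t r by (simp add: \<psi>_def offered_def)
  next
    fix v t assume v: "v \<in> V" and t: "t \<in> set_pmf M"
    have "\<forall>c\<in>set (\<psi> v t). \<exists>n a. (v, c, a) \<in> set (run p \<pi> (t(v := top v)) n)"
      by (auto simp: set_\<psi> offered_def)
    then obtain n where n: "\<And>c. c \<in> set (\<psi> v t) \<Longrightarrow> \<exists>a. (v, c, a) \<in> set (run p \<pi> (t(v := top v)) (n c))"
      by metis
    define N where "N = Max (insert 0 (n ` set (\<psi> v t)))"
    let ?h = "run p \<pi> (t(v := top v)) N"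
    have "set (\<psi> v t) \<subseteq> (\<lambda>e. fst (snd e)) ` set (filter (\<lambda>e. fst e = v) ?h)"
    proof
      fix c assume c: "c \<in> set (\<psi> v t)"
      then obtain a where a: "(v, c, a) \<in> set (run p \<pi> (t(v := top v)) (n c))" using n by blast
      have "n c \<le> N" using c by (simp add: N_def)
      from set_run_mono[OF this] a have "(v, c, a) \<in> set ?h" by blast
      then show "c \<in> (\<lambda>e. fst (snd e)) ` set (filter (\<lambda>e. fst e = v) ?h)" by force
    qed
    then have "card (set (\<psi> v t)) \<le> card (set (filter (\<lambda>e. fst e = v) ?h))"
      by (meson List.finite_set card_image_le card_mono finite_imageI le_trans)
    also have "\<dots> \<le> probes v ?h" unfolding probes_def by (rule card_length)
    also have "\<dots> \<le> K" using feas[OF t_top(1)[OF v t]] by blast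
    finally have "card (set (\<psi> v t)) \<le> K" .
    moreover have "distinct (\<psi> v t)" by (simp add: \<psi>_def)
    ultimately have "length (\<psi> v t) \<le> K" by (simp add: distinct_card)
    then show "\<psi> v t \<in> Q" by (simp add: Psi_def \<psi>_def)
  next
    fix t assume t: "t \<in> set_pmf M"
    define X where "X = {v \<in> V. acc (v, \<psi> v t) t}"
    have "\<exists>n c. (v, c, True) \<in> set (run p \<pi> t n) \<and> pay p v (\<psi> v t) (t v) \<le> c" if "v \<in> X" for v
    proof -
      from that obtain d where v: "v \<in> V" and d: "t v \<le> p v d" "d \<in> set (\<psi> v t)"
        by (auto simp: X_def acc_def)
      then obtain a' n where c': "t v \<le> p v d" "(v, d, a') \<in> set (run p \<pi> (t(v := top v)) n)"
        by (auto simp: set_\<psi> offered_def)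
      from first[OF v t c'(1) disjI2[OF c'(2)]] obtain c where c: "(v, c, True) \<in> set (run p \<pi> t n)" "c \<in> offered v t"
        by blast
      have "pay p v (\<psi> v t) (t v) \<le> c"
      proof (cases "c \<le> B / 2")
        case True
        then have "c \<in> set (\<psi> v t)" using c feasD[OF c(1) t] by (simp add: set_\<psi> small_coupons_def)
        then show ?thesis using run_response[OF c(1)] by (intro pay_le) (auto simp: \<psi>_def sorted_wrt_filter)
      next
        case False
        then show ?thesis
          using pay_cases[of p v "\<psi> v t" "t v"] B_nonneg by (auto simp: set_\<psi> small_coupons_def)
      qed
      then show ?thesis using c by blast
    qed
    then obtain n c where nc: "\<And>v. v \<in> X \<Longrightarrow> (v, c v, True) \<in> set (run p \<pi> t (n v))"
      "\<And>v. v \<in> X \<Longrightarrow> pay p v (\<psi> v t) (t v) \<le> c v" by metis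
    have finX: "finite X" using fin_V by (simp add: X_def)
    define N where "N = Max (insert 0 (n ` X))"
    have N: "(v, c v, True) \<in> set (run p \<pi> t N)" if "v \<in> X" for v
    proof -
      have "n v \<le> N" using that finX by (simp add: N_def)
      from set_run_mono[OF this] nc(1)[OF that] show ?thesis by blast
    qed
    have "(\<Sum>v\<in>V. pay p v (\<psi> v t) (t v)) = (\<Sum>v\<in>X. pay p v (\<psi> v t) (t v))"
    proof (rule sum.mono_neutral_right[OF fin_V])
      show "\<forall>v\<in>V - X. pay p v (\<psi> v t) (t v) = 0"
        using pay_cases[of p _ "\<psi> _ t" "t _"] by (fastforce simp: X_def acc_def)
    qed (auto simp: X_def)
    also have "\<dots> \<le> (\<Sum>v\<in>X. c v)" by (intro sum_mono nc)
    also have "\<dots> \<le> paid (run p \<pi> t N)" using finX N feasD t by (intro sum_le_paid) blast+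
    also have "\<dots> \<le> B" using feas[OF t] by blast
    finally show "(\<Sum>v\<in>V. pay p v (\<psi> v t) (t v)) \<le> B" .
  next
    fix t assume t: "t \<in> set_pmf M"
    define W where "W = {v. \<exists>n c. (v, c, True) \<in> set (run p \<pi> t n) \<and> \<not> c \<le> B / 2}"
    have sub: "accepted p \<pi> t \<subseteq> {v \<in> V. acc (v, \<psi> v t) t} \<union> W"
    proof
      fix v assume "v \<in> accepted p \<pi> t"
      then obtain n c' where c': "(v, c', True) \<in> set (run p \<pi> t n)" by (auto simp: accepted_def)
      have v: "v \<in> V" using feasD[OF c' t] by simp
      have "t v \<le> p v c'" using run_response[OF c'] by simp
      from first[OF v t this disjI1[OF c']] obtain c
        where c: "(v, c, True) \<in> set (run p \<pi> t n)" "c \<in> offered v t" by blast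
      show "v \<in> {v \<in> V. acc (v, \<psi> v t) t} \<union> W"
      proof (cases "c \<le> B / 2")
        case True
        then have "c \<in> set (\<psi> v t)" using c feasD[OF c(1) t] by (simp add: set_\<psi> small_coupons_def)
        then show ?thesis using v run_response[OF c(1)] by (auto simp: acc_def)
      qed (use c in \<open>auto simp: W_def\<close>)
    qed
    \<comment> \<open>Coupons above B / 2 redeemed by two users would together exceed
      \<open>B\<close>.\<close>
    have single: "v = w" if vw: "v \<in> W" "w \<in> W" for v w
    proof (rule ccontr)
      assume ne: "v \<noteq> w"
      from vw obtain n m c d where
        c: "(v, c, True) \<in> set (run p \<pi> t n)" "\<not> c \<le> B / 2" and d: "(w, d, True) \<in> set (run p \<pi> t m)" "\<not> d \<le> B / 2"
        by (auto simp: W_def)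
      let ?h = "run p \<pi> t (max n m)"
      have "(v, c, True) \<in> set ?h" "(w, d, True) \<in> set ?h"
        using c d set_run_mono[of n "max n m" p \<pi> t] set_run_mono[of m "max n m" p \<pi> t] by auto
      then have "(\<Sum>u\<in>{v, w}. if u = v then c else d) \<le> paid ?h"
        using ne feasD t by (intro sum_le_paid) (auto split: if_splits)
      moreover have "paid ?h \<le> B" using feas[OF t] by blast
      ultimately show False using ne c d by simp
    qed
    have win: "\<exists>c. v \<in> V \<and> c \<in> C \<and> t v \<le> p v c" if "v \<in> W" for v
    proof -
      from that obtain n c where c: "(v, c, True) \<in> set (run p \<pi> t n)" by (auto simp: W_def)
      from feasD[OF c t] run_response[OF c] show ?thesis by blast
    qed
    have "W = {} \<or> (\<exists>v c. W = {v} \<and> v \<in> V \<and> c \<in> C \<and> t v \<le> p v c)"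
    proof (cases "W = {}")
      case False
      then obtain v where v: "v \<in> W" by blast
      then have "W = {v}" using single by (intro equalityI subsetI) auto
      with win[OF v] show ?thesis by blast
    qed simp
    with sub show "\<exists>W. accepted p \<pi> t \<subseteq> {v \<in> V. acc (v, \<psi> v t) t} \<union> W \<and>
           (W = {} \<or> (\<exists>v c. W = {v} \<and> v \<in> V \<and> c \<in> C \<and> t v \<le> p v c))"
      by blast
  qed
qed

lemma accepted_subset:
  assumes "\<And>h v c. \<pi> h = Some (v, c) \<Longrightarrow> v \<in> V"
  shows "accepted p \<pi> t \<subseteq> V"
proof -
  have "v \<in> V" if "(v, c, a) \<in> set (run p \<pi> t n)" for v c a n
    using that assms by (induction n) (auto simp: Let_def split: option.splits)
  then show ?thesis by (auto simp: accepted_def)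
qed

lemma accepted_alg2_subset: "valid_alg2_order V I us \<Longrightarrow> accepted p (alg2 us c) t \<subseteq> V"
  by (rule accepted_subset) (auto simp: alg2_def valid_alg2_order_def split: if_splits)

text \<open>A user who accepts any coupon accepts \<open>Max C\<close>, so ALG II stops at her or
  earlier in its order, that is, at a user of at least her singleton value.\<close>

lemma alg2_best:
  assumes us: "valid_alg2_order V I us" and v: "v \<in> V" "c \<in> C" "t v \<le> p v c"
  shows "I {v} \<le> I (accepted p (alg2 us (Max C)) t)"
proof -
  let ?c = "Max C"
  let ?P = "\<lambda>i. i < length us \<and> t (us ! i) \<le> p (us ! i) ?c"
  have "p v c \<le> p v ?c" using v fin_C by (intro p_mono) (auto intro!: Max_in)
  moreover obtain i where i: "i < length us" "us ! i = v"
    using us v by (auto simp: valid_alg2_order_def in_set_conv_nth)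
  ultimately have Pi: "?P i" using v by auto
  define j where "j = (LEAST i. ?P i)"
  have j: "?P j" "j \<le> i" using Pi LeastI[of ?P i] Least_le[of ?P i] by (auto simp: j_def)
  have nj: "\<not> t (us ! k) \<le> p (us ! k) ?c" if "k < j" for k
    using not_less_Least[of k ?P] that j(1) by (auto simp: j_def)
  have "run p (alg2 us ?c) t n = map (\<lambda>u. (u, ?c, False)) (take n us)" if "n \<le> j" for n
    using that
  proof (induction n)
    case (Suc n)
    then have "run p (alg2 us ?c) t n = map (\<lambda>u. (u, ?c, False)) (take n us)" by simp
    moreover have "alg2 us ?c (map (\<lambda>u. (u, ?c, False)) (take n us)) = Some (us ! n, ?c)"
      using Suc.prems j(1) by (auto simp: alg2_def)
    ultimately show ?case
      using Suc.prems j(1) nj[of n] by (simp add: take_Suc_conv_app_nth)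
  qed simp
  from this[of j] have r: "run p (alg2 us ?c) t j = map (\<lambda>u. (u, ?c, False)) (take j us)" by simp
  have "alg2 us ?c (map (\<lambda>u. (u, ?c, False)) (take j us)) = Some (us ! j, ?c)"
    using j(1) by (auto simp: alg2_def)
  then have "(us ! j, ?c, True) \<in> set (run p (alg2 us ?c) t (Suc j))"
    using j(1) by (simp add: r)
  then have acc: "us ! j \<in> accepted p (alg2 us ?c) t" unfolding accepted_def by blast
  have "I {v} \<le> I {us ! j}"
    using us j i by (cases "i = j") (auto simp: valid_alg2_order_def sorted_wrt_iff_nth_less)
  also have "\<dots> \<le> I (accepted p (alg2 us ?c) t)"
    using acc by (intro I_mono accepted_alg2_subset us) auto
  finally show ?thesis .
qed

text \<open>Subadditivity separates the menu acceptances, of mean value \<open>O'\<close>, from the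
  at most one user of \<open>W\<close>, whom ALG II dominates. It dominates each menu acceptance
  singly as well, which gives the crude bound with \<open>card V\<close>.\<close>

lemma policy_bound:
  fixes u2 :: real
  assumes us: "valid_alg2_order V I us"
    and feas: "\<And>t n. t \<in> set_pmf M \<Longrightarrow> (\<forall>(v, c, a)\<in>set (run p \<pi> t n). v \<in> V \<and> c \<in> C)
       \<and> (\<forall>v. probes v (run p \<pi> t n) \<le> K) \<and> paid (run p \<pi> t n) \<le> B"
    and u2: "u2 = expect M (\<lambda>t. I (accepted p (alg2 us (Max C)) t))"
  obtains O' :: real and x where "\<And>s. s \<in> S \<Longrightarrow> 0 \<le> x s \<and> x s \<le> 1" "\<And>v. v \<in> V \<Longrightarrow> (\<Sum>q\<in>Q. x (v, q)) = 1"
    "(\<Sum>s\<in>S. x s * cost s) \<le> B" "\<And>y. O' - 2 * F y \<le> (\<Sum>s\<in>S. gain y s * x s)"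
    "0 \<le> O'" "O' \<le> card V * u2" "expect M (\<lambda>t. I (accepted p \<pi> t)) \<le> O' + u2"
proof -
  from policy_comparator[of \<pi>, OF feas] obtain \<psi> where \<psi>: "\<And>v t. v \<in> V \<Longrightarrow> t \<in> set_pmf M \<Longrightarrow> \<psi> v t \<in> Q"
    "\<And>v t r. \<psi> v (t(v := r)) = \<psi> v t"
    "\<And>t. t \<in> set_pmf M \<Longrightarrow> (\<Sum>v\<in>V. pay p v (\<psi> v t) (t v)) \<le> B"
    "\<And>t. t \<in> set_pmf M \<Longrightarrow> \<exists>W. accepted p \<pi> t \<subseteq> {v \<in> V. acc (v, \<psi> v t) t} \<union> W \<and>
           (W = {} \<or> (\<exists>v c. W = {v} \<and> v \<in> V \<and> c \<in> C \<and> t v \<le> p v c))"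
    by blast
  define x where "x s = expect M (\<lambda>t. of_bool (\<psi> (fst s) t = snd s))" for s
  define O' where "O' = expect M (\<lambda>t. I {v \<in> V. acc (v, \<psi> v t) t})"
  let ?b = "\<lambda>t. I (accepted p (alg2 us (Max C)) t)"
  have b0: "0 \<le> ?b t" for t by (intro I_nonneg accepted_alg2_subset us)
  have x01: "0 \<le> x s \<and> x s \<le> 1" for s
  proof -
    have "x s \<le> expect M (\<lambda>_. 1)" unfolding x_def by (intro expect_mono fin_M) auto
    then show ?thesis by (auto simp: x_def intro!: expect_nonneg)
  qed
  have x_user: "(\<Sum>q\<in>Q. x (v, q)) = 1" if "v \<in> V" for v
  proof -
    have "(\<Sum>q\<in>Q. x (v, q)) = expect M (\<lambda>t. \<Sum>q\<in>Q. of_bool (\<psi> v t = q))"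
      by (simp add: x_def expect_sum[OF fin_M])
    also have "\<dots> = expect M (\<lambda>t. 1)"
      using \<psi>(1)[OF \<open>v \<in> V\<close>] fin_Q by (intro expect_cong) simp
    finally show ?thesis by simp
  qed
  have x_cost: "(\<Sum>s\<in>S. x s * cost s) \<le> B"
  proof -
    have "(\<Sum>s\<in>S. x s * cost s) = expect M (\<lambda>t. \<Sum>v\<in>V. pay p v (\<psi> v t) (t v))"
      unfolding x_def by (rule comparator_cost[OF \<psi>(1,2)])
    also have "\<dots> \<le> expect M (\<lambda>t. B)" using \<psi> by (intro expect_mono fin_M) auto
    finally show ?thesis by simp
  qed
  have x_gain: "O' - 2 * F y \<le> (\<Sum>s\<in>S. gain y s * x s)" for y
    unfolding O'_def x_def by (rule comparator_gain[OF \<psi>(1,2)])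
  have O'0: "0 \<le> O'" unfolding O'_def by (intro expect_nonneg I_nonneg) auto
  have O'_card: "O' \<le> card V * u2"
  proof -
    have "O' \<le> expect M (\<lambda>t. card V * ?b t)" unfolding O'_def
    proof (intro expect_mono fin_M)
      fix t assume t: "t \<in> set_pmf M"
      let ?U = "{v \<in> V. acc (v, \<psi> v t) t}"
      have "I ?U \<le> I {} + (\<Sum>v\<in>?U. I ({} \<union> {v}) - I {})"
        using I_Un_le_sum[of ?U "{}"] fin_V by auto
      also have "\<dots> = (\<Sum>v\<in>?U. I {v})" by (simp add: I_empty)
      also have "\<dots> \<le> (\<Sum>v\<in>?U. ?b t)"
      proof (intro sum_mono)
        fix v assume "v \<in> ?U"
        then obtain c where "v \<in> V" "c \<in> set (\<psi> v t)" "t v \<le> p v c" by (auto simp: acc_def)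
        with Q_small[OF \<psi>(1)[OF _ t]] show "I {v} \<le> ?b t" by (intro alg2_best[OF us]) auto
      qed
      also have "\<dots> = card ?U * ?b t" by simp
      also have "\<dots> \<le> card V * ?b t" using fin_V b0 by (intro mult_right_mono) (auto intro!: card_mono)
      finally show "I ?U \<le> card V * ?b t" .
    qed
    then show ?thesis by (simp add: u2)
  qed
  have O'_u2: "expect M (\<lambda>t. I (accepted p \<pi> t)) \<le> O' + u2"
  proof -
    have "expect M (\<lambda>t. I (accepted p \<pi> t)) \<le> expect M (\<lambda>t. I {v \<in> V. acc (v, \<psi> v t) t} + ?b t)"
    proof (intro expect_mono fin_M)
      fix t assume t: "t \<in> set_pmf M"
      let ?U = "{v \<in> V. acc (v, \<psi> v t) t}"
      from \<psi>(4)[OF t] obtain W where W: "accepted p \<pi> t \<subseteq> ?U \<union> W"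
        "W = {} \<or> (\<exists>v c. W = {v} \<and> v \<in> V \<and> c \<in> C \<and> t v \<le> p v c)" by blast
      have WV: "W \<subseteq> V" using W(2) by auto
      have "I (accepted p \<pi> t) \<le> I (?U \<union> W)" using W(1) WV by (intro I_mono) auto
      also have "\<dots> \<le> I ?U + I W"
        using I_subm[of ?U W, OF _ WV] I_nonneg[of "?U \<inter> W"] by fastforce
      also have "I W \<le> ?b t"
        using W(2) b0[of t] alg2_best[OF us] by (auto simp: I_empty)
      finally show "I (accepted p \<pi> t) \<le> I ?U + ?b t" by simp
    qed
    then show ?thesis
      by (simp add: O'_def u2 expect_add[OF fin_M])
  qed
  show thesis
    by (rule that[of x O']) (use x01 x_user x_cost x_gain O'0 O'_card O'_u2 in blast)+
qed

end

subsection \<open>Executing a list of actions\<close>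

text \<open>The complete history of \<open>seqpol\<close> against fixed thresholds, produced by the
  same recursion. Reasoning about the policy becomes reasoning about this list, of which every run
  is a prefix.\<close>

fun exec_hist :: "('v \<Rightarrow> real \<Rightarrow> real) \<Rightarrow> ('v \<Rightarrow> real) \<Rightarrow> real \<Rightarrow> real \<Rightarrow> ('v \<times> real list) list \<Rightarrow> 'v hist" where
  "exec_hist p t B b [] = []"
| "exec_hist p t B b ((v, \<psi>) # L) =
     (if b < B / 2 then exec_hist p t B b L
      else (case \<psi> of
              [] \<Rightarrow> exec_hist p t B b L
            | c # \<psi>' \<Rightarrow> (if t v \<le> p v c then (v, c, True) # exec_hist p t B (b - c) L
                          else (v, c, False) # exec_hist p t B b ((v, \<psi>') # L))))"

lemma exec_hist_simps [simp]:
  "b < B / 2 \<Longrightarrow> exec_hist p t B b ((v, \<psi>) # L) = exec_hist p t B b L"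
  "exec_hist p t B b ((v, []) # L) = exec_hist p t B b L"
  "\<not> b < B / 2 \<Longrightarrow> exec_hist p t B b ((v, c # \<psi>) # L)
    = (if t v \<le> p v c then (v, c, True) # exec_hist p t B (b - c) L
       else (v, c, False) # exec_hist p t B b ((v, \<psi>) # L))"
  by simp_all

lemma seqpol_simps [simp]:
  "b < B / 2 \<Longrightarrow> seqpol B b ((v, \<psi>) # L) h = seqpol B b L h"
  "seqpol B b ((v, []) # L) h = seqpol B b L h"
  "\<not> b < B / 2 \<Longrightarrow> seqpol B b ((v, c # \<psi>) # L) [] = Some (v, c)"
  "\<not> b < B / 2 \<Longrightarrow> seqpol B b ((v, c # \<psi>) # L) (e # h)
    = (if snd (snd e) then seqpol B (b - c) L h else seqpol B b ((v, \<psi>) # L) h)"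
  by simp_all

declare exec_hist.simps(2) [simp del] seqpol.simps(2) [simp del]

lemma exec_hist_induct [case_names Nil skip empty accept reject]:
  assumes "\<And>b. P b []" "\<And>b v \<psi> L. b < B / 2 \<Longrightarrow> P b L \<Longrightarrow> P b ((v, \<psi>) # L)"
    "\<And>b v L. \<not> b < B / 2 \<Longrightarrow> P b L \<Longrightarrow> P b ((v, []) # L)"
    "\<And>b v c \<psi> L. \<not> b < B / 2 \<Longrightarrow> t v \<le> p v c \<Longrightarrow> P (b - c) L \<Longrightarrow> P b ((v, c # \<psi>) # L)"
    "\<And>b v c \<psi> L. \<not> b < B / 2 \<Longrightarrow> \<not> t v \<le> p v c \<Longrightarrow> P b ((v, \<psi>) # L) \<Longrightarrow> P b ((v, c # \<psi>) # L)"
  shows "P b L"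
proof (induction L arbitrary: b)
  case (Cons s L)
  note IH = Cons.IH
  obtain v \<psi> where s: "s = (v, \<psi>)" by (cases s)
  show ?case unfolding s
  proof (induction \<psi>)
    case Nil
    then show ?case using assms(2,3) Cons by (cases "b < B / 2") auto
  next
    case (Cons c \<psi>)
    then show ?case using assms(2,4,5) IH by (cases "b < B / 2"; cases "t v \<le> p v c") auto
  qed
qed (rule assms(1))

lemma exec_hist_response: "(v, c, a) \<in> set (exec_hist p t B b L) \<Longrightarrow> a = (t v \<le> p v c)"
proof (induction b L rule: exec_hist_induct[where B = B and t = t and p = p])
  case (accept b v' c' \<psi> L)
  then show ?case by auto
next
  case (reject b v' c' \<psi> L)
  then show ?case by auto
qed auto

text \<open>The policy consumes its history in the order in which \<open>exec_hist\<close> produces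
  it, so after any prefix it resumes exactly there.\<close>

lemma seqpol_exec_hist:
  "seqpol B b L (take n (exec_hist p t B b L)) =
    (if n < length (exec_hist p t B b L)
     then Some (fst (exec_hist p t B b L ! n), fst (snd (exec_hist p t B b L ! n))) else None)"
proof (induction b L arbitrary: n rule: exec_hist_induct[where B = B and t = t and p = p])
  case (accept b v c \<psi> L)
  then show ?case by (cases n) simp_all
next
  case (reject b v c \<psi> L)
  then show ?case by (cases n) simp_all
qed simp_all

lemma run_seqpol: "run p (seqpol B b L) t n = take n (exec_hist p t B b L)"
proof (induction n)
  case (Suc n)
  let ?e = "exec_hist p t B b L"
  show ?case
  proof (cases "n < length ?e")
    case True
    obtain v c a where e: "?e ! n = (v, c, a)" by (cases "?e ! n")
    then have "a = (t v \<le> p v c)" using exec_hist_response True by (metis nth_mem)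
    then show ?thesis using True e by (simp add: Suc seqpol_exec_hist take_Suc_conv_app_nth)
  next
    case False
    then show ?thesis using seqpol_exec_hist[of B b L n p t] by (simp add: Suc)
  qed
qed simp

lemma accepted_seqpol: "accepted p (seqpol B b L) t = {v. \<exists>c. (v, c, True) \<in> set (exec_hist p t B b L)}"
  unfolding accepted_def run_seqpol by (metis order_refl set_take_subset subsetD take_all)

lemma exec_hist_action:
  assumes "\<not> b < B / 2"
  shows "set (exec_hist p t B (b - pay p v \<psi> (t v)) L) \<subseteq> set (exec_hist p t B b ((v, \<psi>) # L))"
    and "\<exists>c\<in>set \<psi>. t v \<le> p v c \<Longrightarrow> \<exists>c. (v, c, True) \<in> set (exec_hist p t B b ((v, \<psi>) # L))"
  using assms by (induction \<psi>) (auto simp: pay_def)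

text \<open>The bound on the payments of \<open>L1\<close> keeps the remaining budget at least B / 2
  until the turn of \<open>(v, \<psi>)\<close>, so nothing up to that point is discarded.\<close>

lemma seqpol_accepts:
  assumes "(\<Sum>s\<leftarrow>L1. pay p (fst s) (snd s) (t (fst s))) \<le> b - B / 2"
    and "\<And>s. s \<in> set L1 \<Longrightarrow> 0 \<le> pay p (fst s) (snd s) (t (fst s))"
    and "\<exists>c\<in>set \<psi>. t v \<le> p v c"
  shows "v \<in> accepted p (seqpol B b (L1 @ (v, \<psi>) # L2)) t"
  using assms(1,2)
proof (induction L1 arbitrary: b)
  case Nil
  then show ?case using exec_hist_action(2)[of b B \<psi> t v p L2] assms(3)
    by (simp add: accepted_seqpol)
next
  case (Cons s L1)
  obtain w q where s: "s = (w, q)" by (cases s)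
  have "0 \<le> (\<Sum>s\<leftarrow>L1. pay p (fst s) (snd s) (t (fst s)))"
    using Cons.prems(2) by (intro sum_list_nonneg) auto
  then have "\<not> b < B / 2" using Cons.prems(1) Cons.prems(2)[of s] by simp
  moreover have "v \<in> accepted p (seqpol B (b - pay p w q (t w)) (L1 @ (v, \<psi>) # L2)) t"
    using Cons.prems s by (intro Cons.IH) auto
  ultimately show ?case
    using exec_hist_action(1)[of b B p t w q "L1 @ (v, \<psi>) # L2"] by (auto simp: s accepted_seqpol)
qed

lemma seqpol_action:
  "seqpol B b L h = Some (v, c) \<Longrightarrow> \<exists>s\<in>set L. fst s = v \<and> c \<in> set (snd s)"
proof (induction L arbitrary: b h)
  case (Cons s L)
  obtain w \<psi> where s: "s = (w, \<psi>)" by (cases s)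
  let ?later = "\<exists>s\<in>set L. fst s = v \<and> c \<in> set (snd s)"
  have "seqpol B b ((w, \<psi>) # L) h = Some (v, c) \<Longrightarrow> (w = v \<and> c \<in> set \<psi>) \<or> ?later" for h
  proof (induction \<psi> arbitrary: h)
    case Nil
    then show ?case using Cons.IH[of b h] by simp
  next
    case (Cons d \<psi>)
    show ?case
    proof (cases "b < B / 2")
      case True
      then show ?thesis using Cons.prems \<open>\<And>b h. seqpol B b L h = Some (v, c) \<Longrightarrow> ?later\<close> by simp
    next
      case False
      then show ?thesis using Cons \<open>\<And>b h. seqpol B b L h = Some (v, c) \<Longrightarrow> ?later\<close>
        by (cases h) (auto split: if_splits)
    qed
  qed
  then show ?case using Cons.prems s by fastforce
qed simp

context coupon_model
begin

section \<open>Marginals along an order of the actions\<close>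

definition dominated_order :: "('v \<times> real list) list \<Rightarrow> bool" where
  "dominated_order xs \<longleftrightarrow> distinct xs \<and> set xs = S
     \<and> sorted_wrt (\<lambda>s s'. \<forall>t. fst s = fst s' \<longrightarrow> acc s' t \<longrightarrow> acc s t) xs"

lemma dominated_orderD:
  assumes "dominated_order xs"
  shows "distinct xs" "set xs = S"
    "j < k \<Longrightarrow> k < length xs \<Longrightarrow> fst (xs ! j) = fst (xs ! k) \<Longrightarrow> acc (xs ! k) t \<Longrightarrow> acc (xs ! j) t"
proof -
  show "distinct xs" "set xs = S" using assms unfolding dominated_order_def by blast+
  show "acc (xs ! j) t" if "j < k" "k < length xs" "fst (xs ! j) = fst (xs ! k)" "acc (xs ! k) t"
  proof -
    have "sorted_wrt (\<lambda>s s'. \<forall>t. fst s = fst s' \<longrightarrow> acc s' t \<longrightarrow> acc s t) xs"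
      using assms unfolding dominated_order_def by blast
    from sorted_wrt_nth_less[OF this that(1,2)] that(3,4) show ?thesis by blast
  qed
qed

text \<open>One threshold per user and monotone attractiveness imply that acceptance from a list is
  decided by its largest coupon, so the lists of one user are nested. Sorting by decreasing largest
  coupon realises the order.\<close>

lemma dominated_order_exists: "\<exists>xs. dominated_order xs"
proof -
  \<comment> \<open>The value - 1 lies below every coupon, so empty lists, which are never accepted,
    come last.\<close>
  define key where "key s = - (if snd s = [] then - 1 else Max (set (snd s)))" for s :: "'v \<times> real list"
  obtain ys where ys: "set ys = S" "distinct ys" using finite_distinct_list[OF fin_S] by blast
  define xs where "xs = sort_key key ys"
  have set_xs: "set xs = S" "distinct xs" using ys by (simp_all add: xs_def)
  have "sorted_wrt (\<lambda>s s'. key s \<le> key s') xs"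
    using sorted_sort_key[of key ys] unfolding xs_def by (simp only: sorted_wrt_map)
  then have "sorted_wrt (\<lambda>s s'. \<forall>t. fst s = fst s' \<longrightarrow> acc s' t \<longrightarrow> acc s t) xs"
  proof (rule sorted_wrt_mono_rel[rotated])
    fix s s' assume s: "s \<in> set xs" "s' \<in> set xs" and le: "key s \<le> key s'"
    have "s \<in> V \<times> Q" "s' \<in> V \<times> Q" using s by (simp_all add: set_xs Actions_def)
    then have Q: "snd s \<in> Q" "snd s' \<in> Q" "fst s \<in> V" by auto
    show "\<forall>t. fst s = fst s' \<longrightarrow> acc s' t \<longrightarrow> acc s t"
    proof (intro allI impI)
      fix t assume eq: "fst s = fst s'" and "acc s' t"
      then obtain c where c: "c \<in> set (snd s')" "t (fst s) \<le> p (fst s) c" by (auto simp: acc_def)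
      from c(1) have ne': "snd s' \<noteq> []" by auto
      have c0: "c \<in> C" "0 \<le> c" using Q_small[OF Q(2) c(1)] by auto
      have "c \<le> (if snd s = [] then - 1 else Max (set (snd s)))"
        using le ne' c(1) by (simp add: key_def split del: if_split)
      with c0 have ne: "snd s \<noteq> []" and *: "c \<le> Max (set (snd s))" by (simp_all split: if_splits)
      have m: "Max (set (snd s)) \<in> set (snd s)" using ne by (intro Max_in) auto
      have "p (fst s) c \<le> p (fst s) (Max (set (snd s)))"
        using Q_small[OF Q(1) m] c0 Q(3) * by (intro p_mono) auto
      with c(2) m show "acc s t" unfolding acc_def by (meson order_trans)
    qed
  qed
  then show ?thesis using set_xs unfolding dominated_order_def by blast
qed

definition paid_by :: "'v \<times> real list \<Rightarrow> ('v \<Rightarrow> real) \<Rightarrow> real" where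
  "paid_by s t = pay p (fst s) (snd s) (t (fst s))"

text \<open>Taken against the sampled actions of \<open>R\<close> before index \<open>i\<close>, not
  against the selected or executed ones, so that it depends neither on contention resolution nor on
  the budget, nor on whether action \<open>i\<close> itself is in \<open>R\<close>.\<close>

definition marginal :: "('v \<times> real list) list \<Rightarrow> nat \<Rightarrow> ('v \<times> real list) set \<Rightarrow> ('v \<Rightarrow> real) \<Rightarrow> real" where
  "marginal xs i R t = I (Acc (R \<inter> set (take i xs)) t \<union> (if acc (xs ! i) t then {fst (xs ! i)} else {}))
     - I (Acc (R \<inter> set (take i xs)) t)"

definition exp_marginal :: "('v \<times> real list) list \<Rightarrow> nat \<Rightarrow> ('v \<times> real list) set \<Rightarrow> real" where
  "exp_marginal xs i R = expect M (marginal xs i R)"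

lemma nth_action:
  assumes "dominated_order xs" "i < length xs"
  shows "xs ! i \<in> S" "fst (xs ! i) \<in> V" "snd (xs ! i) \<in> Q" "xs ! i \<notin> set (take i xs)"
    "set (take (Suc i) xs) = insert (xs ! i) (set (take i xs))"
proof -
  note D = dominated_orderD(1,2)[OF assms(1)]
  show S: "xs ! i \<in> S" using assms(2) nth_mem[of i xs] by (simp only: D)
  then show "fst (xs ! i) \<in> V" "snd (xs ! i) \<in> Q" by (auto simp: Actions_def)
  show "xs ! i \<notin> set (take i xs)" using assms(2) D(1)
    by (auto simp: in_set_conv_nth nth_eq_iff_index_eq)
  show "set (take (Suc i) xs) = insert (xs ! i) (set (take i xs))"
    using assms(2) by (simp add: take_Suc_conv_app_nth)
qed

lemma marginal_nonneg: "dominated_order xs \<Longrightarrow> i < length xs \<Longrightarrow> 0 \<le> marginal xs i R t"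
  unfolding marginal_def using nth_action(2)[of xs i] Acc_subset by (auto intro!: I_mono)

lemma exp_marginal_eq:
  assumes "dominated_order xs" "i < length xs"
  shows "exp_marginal xs i R = f (R \<inter> set (take i xs) \<union> {xs ! i}) - f (R \<inter> set (take i xs))"
  using f_marginal[OF nth_action(2)[OF assms], of _ "snd (xs ! i)"]
  by (simp add: exp_marginal_def marginal_def[abs_def])

lemma exp_marginal_nonneg: "dominated_order xs \<Longrightarrow> i < length xs \<Longrightarrow> 0 \<le> exp_marginal xs i R"
  unfolding exp_marginal_def by (intro expect_nonneg marginal_nonneg)

lemma exp_marginal_antimono:
  "dominated_order xs \<Longrightarrow> i < length xs \<Longrightarrow> R \<subseteq> R' \<Longrightarrow> exp_marginal xs i R' \<le> exp_marginal xs i R"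
  unfolding exp_marginal_eq by (intro f_diminishing) auto

lemma exp_marginal_insert:
  "dominated_order xs \<Longrightarrow> i < length xs \<Longrightarrow> exp_marginal xs i (insert (xs ! i) R) = exp_marginal xs i R"
  using nth_action(4)[of xs i] by (simp add: exp_marginal_eq Int_insert_left)

text \<open>Since \<open>E\<close> is contained in \<open>R\<close>, diminishing returns make each
  marginal against \<open>R\<close> an underestimate of the one against \<open>E\<close>, and the
  latter telescope.\<close>

lemma I_Acc_ge_marginals:
  assumes xs: "dominated_order xs" and E: "E \<subseteq> R" "E \<subseteq> S"
  shows "(\<Sum>i<length xs. of_bool (xs ! i \<in> E) * marginal xs i R t) \<le> I (Acc E t)"
proof -
  have "(\<Sum>i<j. of_bool (xs ! i \<in> E) * marginal xs i R t) \<le> I (Acc (E \<inter> set (take j xs)) t)"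
    if "j \<le> length xs" for j
    using that
  proof (induction j)
    case 0
    then show ?case by (simp add: Acc_def I_empty)
  next
    case (Suc j)
    then have j: "j < length xs" by simp
    note nth = nth_action[OF xs j]
    show ?case
    proof (cases "xs ! j \<in> E")
      case True
      let ?X = "if acc (xs ! j) t then {fst (xs ! j)} else {}"
      have "marginal xs j R t \<le> I (Acc (E \<inter> set (take j xs)) t \<union> ?X) - I (Acc (E \<inter> set (take j xs)) t)"
        unfolding marginal_def using E nth(2) by (intro I_diminishing Acc_mono Acc_subset) auto
      moreover have "Acc (E \<inter> set (take (Suc j) xs)) t = Acc (E \<inter> set (take j xs)) t \<union> ?X"
        using True nth(2) Acc_insert[of "fst (xs ! j)" "E \<inter> set (take j xs)" "snd (xs ! j)" t]
        by (simp add: nth(5))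
      ultimately show ?thesis using Suc j True by simp
    next
      case False
      then show ?thesis using Suc j by (simp add: nth(5))
    qed
  qed
  from this[of "length xs"] show ?thesis using E by (simp add: dominated_orderD[OF xs] Int_absorb2)
qed

text \<open>The order of the actions matters here: within one user the actions come in order of
  decreasing acceptance, so whenever \<^term>\<open>s'\<close> is paid for, its user is already among the
  accepting ones of \<^term>\<open>R \<inter> set (take i xs)\<close>, or has no action there at all.\<close>
lemma payment_marginal_correlation:
  assumes xs: "dominated_order xs" and i: "i < length xs"
    and s': "s' \<in> R" "s' \<in> S" "fst s' \<noteq> fst (xs ! i)"
  shows "expect M (\<lambda>t. paid_by s' t * marginal xs i R t) \<le> cost s' * exp_marginal xs i R"
proof -
  obtain v q where s'_eq: "s' = (v, q)" by (cases s')
  have v: "v \<in> V" "q \<in> Q" using s'(2) by (auto simp: s'_eq Actions_def)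
  let ?R = "R \<inter> set (take i xs)"
  have key: "pay p v q r * marginal xs i R (t(v := r)) \<le> pay p v q r * marginal xs i R (t(v := r'))" for t r r'
  proof (cases "pay p v q r = 0")
    case False
    then have acc_r: "acc s' (t(v := r))" using pay_cases[of p v q r] by (auto simp: acc_def s'_eq)
    have sub: "Acc ?R (t(v := r')) \<subseteq> Acc ?R (t(v := r))"
    proof
      fix w assume w: "w \<in> Acc ?R (t(v := r'))"
      show "w \<in> Acc ?R (t(v := r))"
      proof (cases "w = v")
        case False
        then show ?thesis using w Acc_fun_upd[of ?R t v r] Acc_fun_upd[of ?R t v r'] by blast
      next
        case True
        with w obtain q' where q': "(v, q') \<in> R" "(v, q') \<in> set (take i xs)" by (auto simp: Acc_def)
        from q'(2) obtain j where j: "j < i" "j < length xs" "xs ! j = (v, q')"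
          using i by (auto simp: in_set_conv_nth)
        obtain k where k: "k < length xs" "xs ! k = s'"
          using s'(2) dominated_orderD(2)[OF xs] by (metis in_set_conv_nth)
        show ?thesis
        proof (cases "k < i")
          case True
          then have "s' \<in> set (take i xs)" using k i by (auto simp: in_set_conv_nth intro!: exI[of _ k])
          with acc_r s'(1) v \<open>w = v\<close> show ?thesis by (auto simp: Acc_def s'_eq)
        next
          case False
          then have "j < k" using j by simp
          then have "acc (v, q') (t(v := r))"
            using dominated_orderD(3)[OF xs, of j k] k j acc_r by (simp add: s'_eq)
          with q' v \<open>w = v\<close> show ?thesis by (auto simp: Acc_def)
        qed
      qed
    qed
    have "acc (xs ! i) (t(v := r)) = acc (xs ! i) (t(v := r'))"
      using s'(3) by (simp add: acc_def s'_eq)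
    then have "marginal xs i R (t(v := r)) \<le> marginal xs i R (t(v := r'))"
      unfolding marginal_def using nth_action(2)[OF xs i]
      by (simp only:) (intro I_diminishing sub Acc_subset, simp)
    then show ?thesis using pay_nonneg[OF v(2)] by (intro mult_left_mono) auto
  qed simp
  have "expect M (\<lambda>t. paid_by s' t * marginal xs i R t)
      = expect M (\<lambda>t. expect (D v) (\<lambda>r. pay p v q r * marginal xs i R (t(v := r))))"
    by (subst resample[OF v(1)]) (simp add: paid_by_def s'_eq)
  \<comment> \<open>By \<open>key\<close> the marginal at \<open>r\<close> may be averaged over an
    independent \<open>r'\<close>; payment and marginal then factor.\<close>
  also have "\<dots> \<le> expect M (\<lambda>t. expect (D v) (\<lambda>r. pay p v q r * expect (D v) (\<lambda>r'. marginal xs i R (t(v := r')))))"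
  proof (intro expect_mono fin_M fin_D)
    fix t r
    have "pay p v q r * marginal xs i R (t(v := r)) = expect (D v) (\<lambda>r'. pay p v q r * marginal xs i R (t(v := r)))"
      by simp
    also have "\<dots> \<le> expect (D v) (\<lambda>r'. pay p v q r * marginal xs i R (t(v := r')))"
      by (intro expect_mono fin_D key)
    finally show "pay p v q r * marginal xs i R (t(v := r))
        \<le> pay p v q r * expect (D v) (\<lambda>r'. marginal xs i R (t(v := r')))" by simp
  qed
  also have "\<dots> = cost s' * expect M (\<lambda>t. expect (D v) (\<lambda>r'. marginal xs i R (t(v := r'))))"
    by (simp add: cost_def s'_eq)
  also have "\<dots> = cost s' * exp_marginal xs i R"
    unfolding exp_marginal_def by (subst resample[OF v(1), symmetric]) simp
  finally show ?thesis .
qed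

text \<open>Markov's inequality in pointwise form: payments above B / 2 before \<open>s\<close> make
  the left side at most 0. Counting the payments of the whole list without \<open>s\<close> makes
  the bound insensitive to the order of execution.\<close>

lemma executed_ge:
  assumes B: "s \<in> set L" "distinct L" "set L \<subseteq> S"
  shows "1 - 2 / B * (\<Sum>s'\<in>set L - {s}. paid_by s' t)
    \<le> of_bool (\<exists>L1 L2. L = L1 @ s # L2 \<and> (\<Sum>s'\<leftarrow>L1. paid_by s' t) \<le> B - B / 2)"
proof -
  have pay0: "0 \<le> paid_by s' t" if "s' \<in> S" for s'
    using that by (auto simp: paid_by_def Actions_def intro!: pay_nonneg)
  obtain L1 L2 where L: "L = L1 @ s # L2" using B split_list by metis
  have le: "(\<Sum>s'\<leftarrow>L1. paid_by s' t) \<le> (\<Sum>s'\<in>set L - {s}. paid_by s' t)"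
  proof -
    have "(\<Sum>s'\<leftarrow>L1. paid_by s' t) = (\<Sum>s'\<in>set L1. paid_by s' t)"
      using B(2) by (simp add: L sum_list_distinct_conv_sum_set)
    also have "\<dots> \<le> (\<Sum>s'\<in>set L - {s}. paid_by s' t)"
      using B pay0 by (intro sum_mono2) (auto simp: L)
    finally show ?thesis .
  qed
  show ?thesis
  proof (cases "(\<Sum>s'\<leftarrow>L1. paid_by s' t) \<le> B - B / 2")
    case True
    moreover have "0 \<le> 2 / B * (\<Sum>s'\<in>set L - {s}. paid_by s' t)"
      using B_nonneg B pay0 by (intro mult_nonneg_nonneg sum_nonneg) auto
    ultimately show ?thesis using L by auto
  next
    case False
    \<comment> \<open>For \<open>B = 0\<close> the quotient \<open>2 / B\<close> is 0 and the left
      side is 1, so execution must be certain; it is, because all small coupons are then worth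
      0.\<close>
    have "B \<noteq> 0"
    proof
      assume "B = 0"
      have "paid_by s' t = 0" if s': "s' \<in> set L1" for s'
      proof -
        have "snd s' \<in> Q" using s' B(3) by (auto simp: L Actions_def)
        then show ?thesis
          using pay_cases[of p "fst s'" "snd s'" "t (fst s')"] Q_small[of "snd s'"] \<open>B = 0\<close>
          by (fastforce simp: paid_by_def)
      qed
      then have "(\<Sum>s'\<leftarrow>L1. paid_by s' t) = (\<Sum>s'\<leftarrow>L1. 0)"
        by (intro arg_cong[of _ _ sum_list] map_cong) auto
      with False \<open>B = 0\<close> show False by simp
    qed
    with False le B_nonneg have "1 \<le> 2 / B * (\<Sum>s'\<in>set L - {s}. paid_by s' t)"
      by (simp add: field_simps)
    then show ?thesis by simp
  qed
qed

text \<open>Only executed actions are credited with their marginals. Enlarging the payments from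
  \<open>Z\<close> to the costs of all of \<open>R\<close> leaves a bound in which contention
  resolution enters only through membership of \<open>xs ! i\<close> in \<open>Z\<close>.\<close>

lemma seqpol_value_ge:
  assumes xs: "dominated_order xs" and Z: "Z \<subseteq> R" "R \<subseteq> S" "one_per_user Z"
    and L: "distinct L" "set L = Z"
  shows "(\<Sum>i<length xs. of_bool (xs ! i \<in> Z) * ((1 - 2 / B * (\<Sum>s\<in>R - {xs ! i}. cost s)) * exp_marginal xs i R))
    \<le> expect M (\<lambda>t. I (accepted p (seqpol B B L) t))"
proof -
  let ?paid = "\<lambda>i t. 2 / B * (\<Sum>s\<in>Z - {xs ! i}. paid_by s t)"
  have finZ: "finite Z" "finite R" using L Z fin_S finite_subset by auto
  have pt: "(\<Sum>i<length xs. of_bool (xs ! i \<in> Z) * ((1 - ?paid i t) * marginal xs i R t))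
      \<le> I (accepted p (seqpol B B L) t)" for t
  proof -
    define E where "E = {s \<in> Z. \<exists>L1 L2. L = L1 @ s # L2 \<and> (\<Sum>s'\<leftarrow>L1. paid_by s' t) \<le> B - B / 2}"
    have E: "E \<subseteq> R" "E \<subseteq> S" using Z by (auto simp: E_def)
    have "Acc E t \<subseteq> accepted p (seqpol B B L) t"
    proof
      fix v assume "v \<in> Acc E t"
      then obtain q L1 L2 where q: "(v, q) \<in> Z" "acc (v, q) t" "L = L1 @ (v, q) # L2"
        "(\<Sum>s'\<leftarrow>L1. paid_by s' t) \<le> B - B / 2" by (auto simp: Acc_def E_def)
      have "0 \<le> pay p (fst s) (snd s) (t (fst s))" if "s \<in> set L1" for s
        using that q(3) L(2) Z by (intro pay_nonneg) (auto simp: Actions_def)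
      with q show "v \<in> accepted p (seqpol B B L) t"
        by (auto simp: paid_by_def acc_def intro!: seqpol_accepts)
    qed
    moreover have "accepted p (seqpol B B L) t \<subseteq> V"
      using L Z by (intro accepted_subset) (force simp: Actions_def dest: seqpol_action)
    ultimately have 1: "I (Acc E t) \<le> I (accepted p (seqpol B B L) t)" by (intro I_mono)
    have 2: "(\<Sum>i<length xs. of_bool (xs ! i \<in> E) * marginal xs i R t) \<le> I (Acc E t)"
      using xs E by (rule I_Acc_ge_marginals)
    have "of_bool (xs ! i \<in> Z) * ((1 - ?paid i t) * marginal xs i R t)
        \<le> of_bool (xs ! i \<in> E) * marginal xs i R t" if "i < length xs" for i
    proof (cases "xs ! i \<in> Z")
      case True
      then have "1 - ?paid i t \<le> of_bool (xs ! i \<in> E)"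
        using executed_ge[of "xs ! i" L t] L Z by (auto simp: E_def)
      then show ?thesis using True marginal_nonneg[OF xs that] by (simp add: mult_right_mono)
    qed (simp add: E_def)
    then have "(\<Sum>i<length xs. of_bool (xs ! i \<in> Z) * ((1 - ?paid i t) * marginal xs i R t))
        \<le> (\<Sum>i<length xs. of_bool (xs ! i \<in> E) * marginal xs i R t)"
      by (intro sum_mono) simp
    with 1 2 show ?thesis by linarith
  qed
  have "of_bool (xs ! i \<in> Z) * ((1 - 2 / B * (\<Sum>s\<in>R - {xs ! i}. cost s)) * exp_marginal xs i R)
      \<le> expect M (\<lambda>t. of_bool (xs ! i \<in> Z) * ((1 - ?paid i t) * marginal xs i R t))" if i: "i < length xs" for i
  proof (cases "xs ! i \<in> Z")
    case True
    have "expect M (\<lambda>t. \<Sum>s\<in>Z - {xs ! i}. paid_by s t * marginal xs i R t)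
      = (\<Sum>s\<in>Z - {xs ! i}. expect M (\<lambda>t. paid_by s t * marginal xs i R t))"
      by (simp add: expect_sum[OF fin_M])
    also have "\<dots> \<le> (\<Sum>s\<in>Z - {xs ! i}. cost s * exp_marginal xs i R)"
    proof (intro sum_mono payment_marginal_correlation[OF xs i])
      fix s assume s: "s \<in> Z - {xs ! i}"
      then show "s \<in> R" "s \<in> S" using Z by auto
      show "fst s \<noteq> fst (xs ! i)"
        using s True Z(3) unfolding one_per_user_def by (metis DiffE insertI1 prod.collapse)
    qed
    also have "\<dots> \<le> (\<Sum>s\<in>R - {xs ! i}. cost s * exp_marginal xs i R)"
      using Z finZ cost_nonneg exp_marginal_nonneg[OF xs i] by (intro sum_mono2) auto
    finally have "2 / B * expect M (\<lambda>t. \<Sum>s\<in>Z - {xs ! i}. paid_by s t * marginal xs i R t)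
       \<le> 2 / B * (\<Sum>s\<in>R - {xs ! i}. cost s * exp_marginal xs i R)"
      using B_nonneg by (intro mult_left_mono) auto
    moreover have "expect M (\<lambda>t. (1 - ?paid i t) * marginal xs i R t)
        = exp_marginal xs i R - 2 / B * expect M (\<lambda>t. \<Sum>s\<in>Z - {xs ! i}. paid_by s t * marginal xs i R t)"
    proof -
      have "expect M (\<lambda>t. (1 - ?paid i t) * marginal xs i R t)
        = expect M (\<lambda>t. marginal xs i R t - 2 / B * (\<Sum>s\<in>Z - {xs ! i}. paid_by s t * marginal xs i R t))"
        by (simp add: algebra_simps sum_distrib_left sum_distrib_right)
      then show ?thesis by (simp add: expect_diff[OF fin_M] exp_marginal_def)
    qed
    ultimately show ?thesis using True by (simp add: sum_distrib_left sum_distrib_right algebra_simps)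
  qed simp
  then have "(\<Sum>i<length xs. of_bool (xs ! i \<in> Z) * ((1 - 2 / B * (\<Sum>s\<in>R - {xs ! i}. cost s)) * exp_marginal xs i R))
      \<le> (\<Sum>i<length xs. expect M (\<lambda>t. of_bool (xs ! i \<in> Z) * ((1 - ?paid i t) * marginal xs i R t)))"
    by (intro sum_mono) simp
  also have "\<dots> = expect M (\<lambda>t. \<Sum>i<length xs. of_bool (xs ! i \<in> Z) * ((1 - ?paid i t) * marginal xs i R t))"
    by (simp only: expect_sum[OF fin_M])
  also have "\<dots> \<le> expect M (\<lambda>t. I (accepted p (seqpol B B L) t))"
    by (intro expect_mono fin_M pt)
  finally show ?thesis .
qed

text \<open>Along the order, \<open>F x\<close> telescopes into the expected marginals of the
  sampled actions, so the loss factor can be established for one action at a time.\<close>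

lemma alg1_value_ge:
  assumes x: "x \<in> partition_polytope V Q" and x_cost: "(\<Sum>s\<in>S. x s * cost s) \<le> \<beta> * B"
    and \<beta>: "0 \<le> \<beta>" "\<beta> \<le> 1 / 2" and \<gamma>: "0 \<le> \<gamma>"
    and crs: "is_CRS V Q crs" "CRS_monotone V Q crs" "CRS_balanced V Q crs \<gamma>"
    and ord: "valid_order ord S"
  shows "\<gamma> * (1 - 2 * \<beta>) * F x
    \<le> expect (bind_pmf (sample S x) (crs x)) (\<lambda>Z. expect M (\<lambda>t. I (accepted p (seqpol B B (ord Z)) t)))"
proof -
  have SVQ: "S = V \<times> Q" by (simp add: Actions_def)
  obtain xs where xs: "dominated_order xs" using dominated_order_exists by blast
  let ?E = "expect (sample S x)"
  let ?n = "length xs"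
  note fs = finite_set_sample[OF fin_S, of x]
  have x01: "0 \<le> x s" "x s \<le> 1" if "s \<in> S" for s
    using x that by (auto simp: partition_polytope_def SVQ)
  have crsZ: "Z \<subseteq> R" "one_per_user Z" if "Z \<in> set_pmf (crs x R)" "R \<subseteq> S" for Z R
    using crs(1) x that by (auto simp: is_CRS_def SVQ)
  have fin_crs: "finite (set_pmf (crs x R))" if "R \<subseteq> S" for R
  proof (rule finite_subset)
    show "set_pmf (crs x R) \<subseteq> Pow S" using crsZ(1)[OF _ that] that by blast
  qed (simp add: fin_S)
  have fin_crs': "finite (set_pmf (crs x R))" if "R \<in> set_pmf (sample S x)" for R
    using that set_sample[of S x] by (intro fin_crs) blast
  define T where "T i R = 1 - 2 / B * (\<Sum>s\<in>R - {xs ! i}. cost s)" for i R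
  define P where "P i R = measure_pmf.prob (crs x R) {Z. xs ! i \<in> Z}" for i R
  have P_eq: "P i R = expect (crs x R) (\<lambda>Z. of_bool (xs ! i \<in> Z))" for i R
  proof -
    have "(\<lambda>Z. of_bool (xs ! i \<in> Z) :: real) = indicator {Z. xs ! i \<in> Z}" by (auto simp: indicator_def)
    then show ?thesis by (simp add: P_def)
  qed
  have B2: "0 \<le> 2 / B" using B_nonneg by simp
  have ind: "?E (\<lambda>R. of_bool (s \<in> R) * g R) = x s * ?E (\<lambda>R. g (insert s R))" if "s \<in> S" for s g
    using that x01 by (intro expect_sample_indicator fin_S)
  have term_i: "\<gamma> * (1 - 2 * \<beta>) * ?E (\<lambda>R. f (R \<inter> set (take (Suc i) xs)) - f (R \<inter> set (take i xs)))
      \<le> ?E (\<lambda>R. P i R * (T i R * exp_marginal xs i R))" if i: "i < ?n" for i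
  proof -
    let ?s = "xs ! i" and ?m = "exp_marginal xs i"
    note nth = nth_action[OF xs i]
    have P0: "0 \<le> P i R" for R by (simp add: P_def)
    have m0: "0 \<le> ?m R" for R by (rule exp_marginal_nonneg[OF xs i])
    have P_anti: "P i (insert ?s R') \<le> P i (insert ?s R)" if "R \<subseteq> R'" "R' \<subseteq> S" for R R'
    proof -
      have "?s \<in> insert ?s R \<and> insert ?s R \<subseteq> insert ?s R' \<and> insert ?s R' \<subseteq> V \<times> Q"
        using that nth(1) unfolding SVQ by blast
      with bspec[OF crs(2)[unfolded CRS_monotone_def] x] show ?thesis
        unfolding P_def by (simp only: mp)
    qed
    have m_anti: "?m R' \<le> ?m R" if "R \<subseteq> R'" for R R' using that by (rule exp_marginal_antimono[OF xs i])
    have T_anti: "T i R' \<le> T i R" if "R \<subseteq> R'" "R' \<subseteq> S" for R R'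
    proof -
      have "(\<Sum>s\<in>R - {?s}. cost s) \<le> (\<Sum>s\<in>R' - {?s}. cost s)"
        using that fin_S finite_subset cost_nonneg by (intro sum_mono2) blast+
      then show ?thesis unfolding T_def using B2 by (intro diff_left_mono mult_left_mono)
    qed
    have T_ge: "1 - 2 * \<beta> \<le> ?E (T i)"
    proof -
      have "?E (\<lambda>R. \<Sum>s\<in>R - {?s}. cost s) \<le> ?E (\<lambda>R. \<Sum>s\<in>S. of_bool (s \<in> R) * cost s)"
      proof (intro expect_sample_mono fin_S)
        fix R assume R: "R \<subseteq> S"
        have "(\<Sum>s\<in>R - {?s}. cost s) \<le> (\<Sum>s\<in>R. cost s)"
          using R fin_S finite_subset cost_nonneg by (intro sum_mono2) blast+
        also have "\<dots> = (\<Sum>s\<in>S. of_bool (s \<in> R) * cost s)"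
          using R fin_S by (intro sum.mono_neutral_cong_left) auto
        finally show "(\<Sum>s\<in>R - {?s}. cost s) \<le> (\<Sum>s\<in>S. of_bool (s \<in> R) * cost s)" .
      qed
      also have "\<dots> = (\<Sum>s\<in>S. x s * cost s)"
        using ind[of _ "\<lambda>_. cost _"] by (simp add: expect_sum[OF fs] del: integral_mult_left_zero integral_mult_left)
      finally have "2 / B * ?E (\<lambda>R. \<Sum>s\<in>R - {?s}. cost s) \<le> 2 / B * (\<beta> * B)"
        using B2 x_cost by (intro mult_left_mono) auto
      \<comment> \<open>An equality unless \<open>B = 0\<close>, when the left side is 0.\<close>
      also have "\<dots> \<le> 2 * \<beta>" using \<beta> by simp
      finally show ?thesis unfolding T_def by (simp add: expect_diff[OF fs])
    qed
    \<comment> \<open>Balance speaks of the unconditional selection probability. The scheme selects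
      only from \<open>R\<close>, so restricting to samples that contain the action changes
      nothing.\<close>
    have P_ge: "\<gamma> * x ?s \<le> x ?s * ?E (\<lambda>R. P i (insert ?s R))"
    proof (cases "x ?s > 0")
      case True
      have "x ?s * ?E (\<lambda>R. P i (insert ?s R)) = ?E (\<lambda>R. of_bool (?s \<in> R) * P i R)"
        by (rule ind[OF nth(1), symmetric])
      also have "\<dots> = ?E (P i)"
      proof (rule expect_sample_cong)
        fix R assume R: "R \<subseteq> S"
        show "of_bool (?s \<in> R) * P i R = P i R"
        proof (cases "?s \<in> R")
          case False
          then have "P i R = expect (crs x R) (\<lambda>Z. 0)"
            unfolding P_eq using crsZ(1)[OF _ R] by (intro expect_cong) auto
          then show ?thesis by simp
        qed simp
      qed
      also have "\<dots> = expect (bind_pmf (sample S x) (crs x)) (\<lambda>Z. of_bool (?s \<in> Z))"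
        by (simp only: expect_bind[OF fs fin_crs'] P_eq[abs_def])
      also have "\<dots> = measure_pmf.prob (bind_pmf (sample S x) (crs x)) {Z. ?s \<in> Z}"
      proof -
        have "(\<lambda>Z. of_bool (?s \<in> Z) :: real) = indicator {Z. ?s \<in> Z}" by (auto simp: indicator_def)
        then show ?thesis by simp
      qed
      also have "\<dots> \<ge> \<gamma> * x ?s"
        using bspec[OF bspec[OF crs(3)[unfolded CRS_balanced_def] x], of ?s] nth(1) True
        by (simp add: SVQ)
      finally show ?thesis .
    next
      case False
      then have "x ?s = 0" using x01[OF nth(1)] by simp
      then show ?thesis by simp
    qed
    have eq: "?E (\<lambda>R. f (R \<inter> set (take (Suc i) xs)) - f (R \<inter> set (take i xs))) = x ?s * ?E ?m"
    proof -
      have "?E (\<lambda>R. f (R \<inter> set (take (Suc i) xs)) - f (R \<inter> set (take i xs))) = ?E (\<lambda>R. of_bool (?s \<in> R) * ?m R)"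
        by (rule expect_cong) (auto simp: nth(5) exp_marginal_eq[OF xs i] Int_insert_right)
      also have "\<dots> = x ?s * ?E ?m" by (subst ind[OF nth(1)]) (simp add: exp_marginal_insert[OF xs i])
      finally show ?thesis .
    qed
    have xs0: "0 \<le> x ?s" using x01[OF nth(1)] by simp
    have Em0: "0 \<le> ?E ?m" by (intro expect_nonneg m0)
    have EP0: "0 \<le> ?E (\<lambda>R. P i (insert ?s R))" by (intro expect_nonneg P0)
    have "\<gamma> * (1 - 2 * \<beta>) * (x ?s * ?E ?m) = (\<gamma> * x ?s) * ((1 - 2 * \<beta>) * ?E ?m)" by simp
    also have "\<dots> \<le> (x ?s * ?E (\<lambda>R. P i (insert ?s R))) * (?E (T i) * ?E ?m)"
      by (rule mult_mono[OF P_ge mult_right_mono[OF T_ge Em0]]) (use xs0 EP0 Em0 \<beta> in simp_all)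
    also have "\<dots> = x ?s * ((?E (\<lambda>R. P i (insert ?s R)) * ?E ?m) * ?E (T i))" by simp
    also have "\<dots> \<le> x ?s * (?E (\<lambda>R. P i (insert ?s R) * ?m R) * ?E (T i))"
      using xs0 T_ge \<beta> x01 P_anti m_anti
      by (intro mult_left_mono mult_right_mono Harris_antimono fin_S) auto
    \<comment> \<open>\<open>T\<close> may be negative and therefore enters last: the product of the
      two nonnegative decreasing factors is decreasing, and Harris is applied to it and
      \<open>T\<close>.\<close>
    also have "\<dots> \<le> x ?s * ?E (\<lambda>R. (P i (insert ?s R) * ?m R) * T i R)"
      using xs0 x01 P_anti m_anti T_anti P0 m0
      by (intro mult_left_mono Harris_antimono fin_S) (auto intro!: mult_mono)
    also have "\<dots> = x ?s * ?E (\<lambda>R. P i (insert ?s R) * (T i (insert ?s R) * ?m (insert ?s R)))"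
      by (simp add: exp_marginal_insert[OF xs i] T_def mult_ac)
    also have "\<dots> = ?E (\<lambda>R. of_bool (?s \<in> R) * (P i R * (T i R * ?m R)))"
      by (rule ind[OF nth(1), symmetric])
    also have "\<dots> = ?E (\<lambda>R. P i R * (T i R * ?m R))"
    proof (rule expect_sample_cong)
      fix R assume R: "R \<subseteq> S"
      show "of_bool (?s \<in> R) * (P i R * (T i R * ?m R)) = P i R * (T i R * ?m R)"
      proof (cases "?s \<in> R")
        case False
        then have "P i R = expect (crs x R) (\<lambda>Z. 0)"
          unfolding P_eq using crsZ(1)[OF _ R] by (intro expect_cong) auto
        then show ?thesis by simp
      qed simp
    qed
    finally show ?thesis unfolding eq .
  qed
  have "\<gamma> * (1 - 2 * \<beta>) * F x
      = (\<Sum>i<?n. \<gamma> * (1 - 2 * \<beta>) * ?E (\<lambda>R. f (R \<inter> set (take (Suc i) xs)) - f (R \<inter> set (take i xs))))"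
  proof -
    have "(\<Sum>i<?n. ?E (\<lambda>R. f (R \<inter> set (take (Suc i) xs)) - f (R \<inter> set (take i xs))))
      = ?E (\<lambda>R. f (R \<inter> set (take ?n xs)) - f (R \<inter> set (take 0 xs)))"
      unfolding expect_sum[OF fs, symmetric] by (subst sum_lessThan_telescope) simp
    also have "\<dots> = F x"
      unfolding F_def
      by (rule expect_sample_cong) (simp add: f_empty dominated_orderD[OF xs] Int_absorb2)
    finally show ?thesis by (simp only: sum_distrib_left[symmetric])
  qed
  also have "\<dots> \<le> (\<Sum>i<?n. ?E (\<lambda>R. P i R * (T i R * exp_marginal xs i R)))"
    by (intro sum_mono term_i) simp
  also have "\<dots> = ?E (\<lambda>R. expect (crs x R) (\<lambda>Z. \<Sum>i<?n. of_bool (xs ! i \<in> Z) * (T i R * exp_marginal xs i R)))"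
    unfolding expect_sum[OF fs, symmetric]
  proof (rule expect_sample_cong)
    fix R assume "R \<subseteq> S"
    from expect_sum[OF fin_crs[OF this], of "\<lambda>i Z. of_bool (xs ! i \<in> Z) * (T i R * exp_marginal xs i R)" "{..<?n}"]
    show "(\<Sum>i<?n. P i R * (T i R * exp_marginal xs i R))
      = expect (crs x R) (\<lambda>Z. \<Sum>i<?n. of_bool (xs ! i \<in> Z) * (T i R * exp_marginal xs i R))"
      by (simp add: P_eq)
  qed
  also have "\<dots> \<le> ?E (\<lambda>R. expect (crs x R) (\<lambda>Z. expect M (\<lambda>t. I (accepted p (seqpol B B (ord Z)) t))))"
  proof (rule expect_sample_mono[OF fin_S], rule expect_mono)
    fix R Z assume R: "R \<subseteq> S" and Z: "Z \<in> set_pmf (crs x R)"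
    show "(\<Sum>i<?n. of_bool (xs ! i \<in> Z) * (T i R * exp_marginal xs i R))
      \<le> expect M (\<lambda>t. I (accepted p (seqpol B B (ord Z)) t))"
      unfolding T_def using crsZ[OF Z R] R ord xs
      by (intro seqpol_value_ge) (auto simp: valid_order_def)
  qed (rule fin_crs)
  also have "\<dots> = expect (bind_pmf (sample S x) (crs x)) (\<lambda>Z. expect M (\<lambda>t. I (accepted p (seqpol B B (ord Z)) t)))"
    by (simp only: expect_bind[OF fs fin_crs'])
  finally show ?thesis .
qed

end

subsection \<open>Continuous greedy\<close>

text \<open>The polynomial 1 - 2 a + 2 a^2 bounds exp (- 2 a) from above, because its product with 1
  + 2 a + 2 a^2 \<le> exp (2 a) is 1 + 4 a^4.\<close>

lemma one_minus_exp_ge: "0 \<le> a \<Longrightarrow> a - a\<^sup>2 \<le> (1 - exp (- 2 * a)) / (2 :: real)"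
proof -
  assume a: "0 \<le> a"
  have 1: "1 + 2 * a + 2 * a\<^sup>2 \<le> exp (2 * a)"
    using exp_lower_Taylor_quadratic[of "2 * a"] a by (simp add: power_mult_distrib)
  have 2: "1 - 2 * a + 2 * a\<^sup>2 = (1 - a)\<^sup>2 + a\<^sup>2"
    by (simp add: power2_eq_square algebra_simps)
  have "1 \<le> 1 + 4 * (a\<^sup>2)\<^sup>2" using zero_le_power2[of "a\<^sup>2"] by linarith
  also have "\<dots> = (1 - 2 * a + 2 * a\<^sup>2) * (1 + 2 * a + 2 * a\<^sup>2)"
    by (simp add: algebra_simps power2_eq_square)
  also have "\<dots> \<le> (1 - 2 * a + 2 * a\<^sup>2) * exp (2 * a)"
    using 1 unfolding 2 by (intro mult_left_mono sum_power2_ge_zero)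
  finally have "1 \<le> (1 - 2 * a + 2 * a\<^sup>2) * exp (2 * a)" .
  then have "exp (- 2 * a) \<le> 1 - 2 * a + 2 * a\<^sup>2"
    by (simp add: exp_minus field_simps)
  then show ?thesis by (simp add: field_simps)
qed

context coupon_model
begin

definition lp_feas :: "real \<Rightarrow> ('v \<times> real list \<Rightarrow> real) \<Rightarrow> bool" where
  "lp_feas \<beta> z \<longleftrightarrow> (\<forall>s\<in>S. 0 \<le> z s \<and> z s \<le> 1) \<and> (\<forall>v\<in>V. (\<Sum>q\<in>Q. z (v, q)) \<le> 1)
     \<and> (\<Sum>s\<in>S. z s * cost s) \<le> \<beta> * B"

text \<open>Each step adds \<delta> times an LP solution, so the left side of every constraint grows
  at most linearly; at k \<delta> = 1 the LP constraints themselves hold.\<close>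

lemma greedy_feasible:
  fixes \<delta> :: real
  assumes \<delta>: "0 \<le> \<delta>" and \<beta>: "0 \<le> \<beta>"
    and ys0: "ys 0 = (\<lambda>_. 0)"
    and step: "\<And>k. k < n \<Longrightarrow> \<exists>z. lp_feas \<beta> z \<and> ys (Suc k) = (\<lambda>s. ys k s + \<delta> * z s)"
    and "k \<le> n"
  shows "(\<forall>s\<in>S. 0 \<le> ys k s \<and> ys k s \<le> k * \<delta>) \<and> (\<forall>v\<in>V. (\<Sum>q\<in>Q. ys k (v, q)) \<le> k * \<delta>)
    \<and> (\<Sum>s\<in>S. ys k s * cost s) \<le> k * \<delta> * (\<beta> * B)"
  using \<open>k \<le> n\<close>
proof (induction k)
  case 0
  then show ?case by (simp add: ys0)
next
  case (Suc k)
  then obtain z where z: "lp_feas \<beta> z" and ys: "ys (Suc k) = (\<lambda>s. ys k s + \<delta> * z s)"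
    using step[of k] by auto
  have IH: "\<And>s. s \<in> S \<Longrightarrow> 0 \<le> ys k s \<and> ys k s \<le> k * \<delta>" "\<And>v. v \<in> V \<Longrightarrow> (\<Sum>q\<in>Q. ys k (v, q)) \<le> k * \<delta>"
    "(\<Sum>s\<in>S. ys k s * cost s) \<le> k * \<delta> * (\<beta> * B)"
    using Suc by auto
  have k: "real (Suc k) * \<delta> = k * \<delta> + \<delta> * 1" by (simp add: algebra_simps)
  have "0 \<le> ys (Suc k) s \<and> ys (Suc k) s \<le> Suc k * \<delta>" if "s \<in> S" for s
  proof -
    have zs: "0 \<le> z s" "z s \<le> 1" using z that by (simp_all add: lp_feas_def)
    then have "0 \<le> \<delta> * z s" "\<delta> * z s \<le> \<delta> * 1"
      using \<delta> by (intro mult_nonneg_nonneg mult_left_mono; simp)+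
    then show ?thesis unfolding ys k using IH(1)[OF that] by linarith
  qed
  moreover have "(\<Sum>q\<in>Q. ys (Suc k) (v, q)) \<le> Suc k * \<delta>" if "v \<in> V" for v
  proof -
    have "\<delta> * (\<Sum>q\<in>Q. z (v, q)) \<le> \<delta> * 1" using z \<delta> that by (intro mult_left_mono) (auto simp: lp_feas_def)
    then show ?thesis unfolding k using IH(2)[OF that] by (simp add: ys sum.distrib sum_distrib_left)
  qed
  moreover have "(\<Sum>s\<in>S. ys (Suc k) s * cost s) \<le> Suc k * \<delta> * (\<beta> * B)"
  proof -
    have "\<delta> * (\<Sum>s\<in>S. z s * cost s) \<le> \<delta> * (\<beta> * B)" using z \<delta> by (intro mult_left_mono) (auto simp: lp_feas_def)
    moreover have "(\<Sum>s\<in>S. ys (Suc k) s * cost s) = (\<Sum>s\<in>S. ys k s * cost s) + \<delta> * (\<Sum>s\<in>S. z s * cost s)"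
      by (simp add: ys sum.distrib sum_distrib_left algebra_simps)
    ultimately show ?thesis using IH(3) by (simp add: algebra_simps)
  qed
  ultimately show ?case by blast
qed

text \<open>Each step shrinks the gap \<^term>\<open>O' - 2 * F y\<close> by the factor \<open>1 - 2 * \<kappa>\<close> because
  \<^term>\<open>\<lambda>s. \<beta> * x s\<close> competes in the LP; \<^term>\<open>1 - \<delta> * card V\<close> is the loss of
  second order in \<^term>\<open>\<delta>\<close>.\<close>
lemma greedy_value:
  fixes \<delta> O' :: real
  assumes n: "n * \<delta> = 1" and \<delta>: "0 \<le> \<delta>" "\<delta> * card V \<le> 1" "\<delta> \<le> 1" and \<beta>: "0 \<le> \<beta>" "\<beta> \<le> 1 / 2"
    and ys0: "ys 0 = (\<lambda>_. 0)"
    and step: "\<And>k. k < n \<Longrightarrow> \<exists>z. lp_feas \<beta> z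
       \<and> (\<forall>z'. lp_feas \<beta> z' \<longrightarrow> (\<Sum>s\<in>S. gain (ys k) s * z' s) \<le> (\<Sum>s\<in>S. gain (ys k) s * z s))
       \<and> ys (Suc k) = (\<lambda>s. ys k s + \<delta> * z s)"
    and x: "\<And>s. s \<in> S \<Longrightarrow> 0 \<le> x s \<and> x s \<le> 1" "\<And>v. v \<in> V \<Longrightarrow> (\<Sum>q\<in>Q. x (v, q)) = 1"
      "(\<Sum>s\<in>S. x s * cost s) \<le> B" "\<And>y. O' - 2 * F y \<le> (\<Sum>s\<in>S. gain y s * x s)" "0 \<le> O'"
  shows "(1 - \<delta> * card V) * (\<beta> * (1 - \<beta>) * O') \<le> F (ys n)"
proof -
  define e where "e = 1 - \<delta> * card V"
  define \<kappa> where "\<kappa> = e * \<beta> * \<delta>"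
  have e: "0 \<le> e" "e \<le> 1" using \<delta> by (auto simp: e_def)
  have feas: "\<exists>z. lp_feas \<beta> z \<and> ys (Suc k) = (\<lambda>s. ys k s + \<delta> * z s)" if "k < n" for k
    using step[OF that] by blast
  have \<kappa>: "0 \<le> \<kappa>" "2 * \<kappa> \<le> 1"
  proof -
    have "e * \<beta> \<le> 1 * (1 / 2)" using e \<beta> by (intro mult_mono) auto
    then have "e * \<beta> * \<delta> \<le> (1 / 2) * 1" using e \<beta> \<delta> by (intro mult_mono) auto
    then show "0 \<le> \<kappa>" "2 * \<kappa> \<le> 1" using e \<beta> \<delta> by (auto simp: \<kappa>_def)
  qed
  have bx: "lp_feas \<beta> (\<lambda>s. \<beta> * x s)"
  proof -
    have "\<beta> * (\<Sum>s\<in>S. x s * cost s) \<le> \<beta> * B" using x(3) \<beta> by (intro mult_left_mono)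
    moreover have "(\<Sum>q\<in>Q. \<beta> * x (v, q)) \<le> 1" if "v \<in> V" for v
      using x(2)[OF that] \<beta> by (simp add: sum_distrib_left[symmetric])
    moreover have "\<beta> * x s \<le> 1" if "s \<in> S" for s
      using x(1)[OF that] \<beta> by (intro mult_le_one) auto
    ultimately show ?thesis
      using x(1) \<beta> by (auto simp: lp_feas_def sum_distrib_left mult.assoc)
  qed
  have gap: "O' - 2 * F (ys k) \<le> (1 - 2 * \<kappa>) ^ k * O'" if "k \<le> n" for k
    using that
  proof (induction k)
    case 0
    then show ?case by (simp add: ys0 F_zero)
  next
    case (Suc k)
    then have k: "k < n" by simp
    from step[OF k] obtain z where z: "lp_feas \<beta> z"
      "\<And>z'. lp_feas \<beta> z' \<Longrightarrow> (\<Sum>s\<in>S. gain (ys k) s * z' s) \<le> (\<Sum>s\<in>S. gain (ys k) s * z s)"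
      "ys (Suc k) = (\<lambda>s. ys k s + \<delta> * z s)" by blast
    have "real (Suc k) * \<delta> \<le> real n * \<delta>" using k \<delta> by (intro mult_right_mono) auto
    then have k1: "real (Suc k) * \<delta> \<le> 1" using n by simp
    have y: "0 \<le> ys k s \<and> ys k s + \<delta> * z s \<le> 1" if "s \<in> S" for s
    proof -
      have "0 \<le> ys k s"
        using greedy_feasible[OF \<delta>(1) \<beta>(1) ys0 feas, of n k] k that by auto
      moreover have "ys (Suc k) s \<le> real (Suc k) * \<delta>"
        using greedy_feasible[OF \<delta>(1) \<beta>(1) ys0 feas, of n "Suc k"] k that by auto
      ultimately show ?thesis using k1 unfolding z(3) by simp
    qed
    have "\<beta> * (O' - 2 * F (ys k)) \<le> \<beta> * (\<Sum>s\<in>S. gain (ys k) s * x s)"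
      using x(4) \<beta> by (intro mult_left_mono)
    also have "\<dots> = (\<Sum>s\<in>S. gain (ys k) s * (\<beta> * x s))" by (simp add: sum_distrib_left algebra_simps)
    also have "\<dots> \<le> (\<Sum>s\<in>S. gain (ys k) s * z s)" by (rule z(2)[OF bx])
    finally have W: "\<beta> * (O' - 2 * F (ys k)) \<le> (\<Sum>s\<in>S. gain (ys k) s * z s)" .
    have "F (ys k) + \<kappa> * (O' - 2 * F (ys k)) = F (ys k) + \<delta> * e * (\<beta> * (O' - 2 * F (ys k)))"
      by (simp add: \<kappa>_def)
    also have "\<dots> \<le> F (ys k) + \<delta> * e * (\<Sum>s\<in>S. gain (ys k) s * z s)"
      using W \<delta> e by (intro add_left_mono mult_left_mono) auto
    also have "\<dots> \<le> F (ys (Suc k))"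
      unfolding z(3) e_def using z(1) y \<delta> by (intro F_step) (auto simp: lp_feas_def)
    finally have "O' - 2 * F (ys (Suc k)) \<le> (1 - 2 * \<kappa>) * (O' - 2 * F (ys k))"
      by (simp add: algebra_simps)
    also have "\<dots> \<le> (1 - 2 * \<kappa>) * ((1 - 2 * \<kappa>) ^ k * O')"
      using Suc \<kappa> by (intro mult_left_mono) auto
    finally show ?case by simp
  qed
  have "(1 - 2 * \<kappa>) ^ n \<le> exp (- 2 * \<kappa>) ^ n"
    using \<kappa> exp_ge_add_one_self[of "- 2 * \<kappa>"] by (intro power_mono) auto
  also have "\<dots> = exp (real n * (- 2 * \<kappa>))" by (rule exp_of_nat_mult[symmetric])
  also have "real n * (- 2 * \<kappa>) = - 2 * (e * \<beta>) * (real n * \<delta>)" by (simp add: \<kappa>_def)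
  also have "\<dots> = - 2 * (e * \<beta>)" using n by simp
  finally have "(1 - 2 * \<kappa>) ^ n \<le> exp (- 2 * (e * \<beta>))" .
  then have "(1 - 2 * \<kappa>) ^ n * O' \<le> exp (- 2 * (e * \<beta>)) * O'" using x(5) by (rule mult_right_mono)
  with gap[of n] have "(1 - exp (- 2 * (e * \<beta>))) / 2 * O' \<le> F (ys n)"
    by (simp add: algebra_simps)
  \<comment> \<open>The loss \<open>e\<close> sits in the exponent; because \<open>e\<close> is at
    most 1 it can be pulled out as a plain factor.\<close>
  moreover have "e * (\<beta> * (1 - \<beta>)) \<le> (1 - exp (- 2 * (e * \<beta>))) / 2"
  proof -
    have "e * \<beta> * (e * \<beta>) \<le> e * \<beta> * (1 * \<beta>)" using e \<beta> by (intro mult_left_mono mult_right_mono) auto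
    then have "e * (\<beta> * (1 - \<beta>)) \<le> e * \<beta> - (e * \<beta>)\<^sup>2" by (simp add: algebra_simps power2_eq_square)
    also have "\<dots> \<le> (1 - exp (- 2 * (e * \<beta>))) / 2" using e \<beta> by (intro one_minus_exp_ge) auto
    finally show ?thesis .
  qed
  then have "e * (\<beta> * (1 - \<beta>)) * O' \<le> (1 - exp (- 2 * (e * \<beta>))) / 2 * O'"
    using x(5) by (rule mult_right_mono)
  ultimately show ?thesis by (simp add: e_def mult.assoc)
qed

end

subsection \<open>Finite discretisation of the thresholds\<close>

text \<open>The image of \<open>N\<close> under \<open>h\<close>; \<open>Abs_pmf\<close> is
  meaningful only when the image is discrete, which the following locale guarantees.\<close>

definition discr_pmf :: "'a measure \<Rightarrow> ('a \<Rightarrow> 'b) \<Rightarrow> 'b pmf" where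
  "discr_pmf N h = Abs_pmf (distr N (count_space UNIV) h)"

locale finite_valued = prob_space N for N :: "'a measure" +
  fixes h :: "'a \<Rightarrow> 'b" and A :: "'b set"
  assumes fin_A: "finite A" and h_A: "\<And>x. h x \<in> A"
    and h_sets: "\<And>a. a \<in> A \<Longrightarrow> h -` {a} \<inter> space N \<in> sets N"
begin

lemma h_measurable: "h \<in> measurable N (count_space UNIV)"
proof -
  have "h \<in> measurable N (count_space A)"
    using h_A h_sets by (subst measurable_count_space_eq2[OF fin_A]) auto
  moreover have "(\<lambda>x. x) \<in> measurable (count_space A) (count_space UNIV)" by simp
  ultimately show ?thesis using measurable_compose by blast
qed

text \<open>Almost all mass lies in the finite set \<open>A\<close>, whose points of mass zero form
  a null set; so almost every point has positive mass, as a pmf requires.\<close>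

lemma measure_discr_pmf: "measure_pmf (discr_pmf N h) = distr N (count_space UNIV) h"
proof -
  let ?D = "distr N (count_space UNIV) h"
  interpret D: prob_space ?D using h_measurable by (rule prob_space_distr)
  have "AE x in ?D. x \<in> A"
    using h_A by (subst AE_distr_iff[OF h_measurable]) auto
  moreover have "AE x in ?D. x \<notin> {a \<in> A. measure ?D {a} = 0}"
  proof (rule AE_not_in)
    have "(\<Union>a\<in>{a \<in> A. measure ?D {a} = 0}. {a}) \<in> null_sets ?D"
      using fin_A by (intro null_sets.finite_UN) (auto simp: null_sets_def D.emeasure_eq_measure)
    then show "{a \<in> A. measure ?D {a} = 0} \<in> null_sets ?D" by simp
  qed
  ultimately have "AE x in ?D. measure ?D {x} \<noteq> 0" by eventually_elim auto
  then show ?thesis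
    unfolding discr_pmf_def using D.prob_space_axioms by (intro Abs_pmf_inverse) auto
qed

lemma expect_discr_pmf: "expect (discr_pmf N h) g = (\<integral>x. g (h x) \<partial>N)"
  unfolding measure_discr_pmf by (rule integral_distr[OF h_measurable]) simp

lemma pmf_discr_pmf: "pmf (discr_pmf N h) a = measure N (h -` {a} \<inter> space N)"
  unfolding pmf.rep_eq measure_discr_pmf by (rule measure_distr[OF h_measurable]) simp

lemma AE_discr_pmf: "(AE x in N. P (h x)) \<longleftrightarrow> (\<forall>a\<in>set_pmf (discr_pmf N h). P a)"
  unfolding AE_measure_pmf_iff[symmetric] measure_discr_pmf
  by (rule AE_distr_iff[OF h_measurable, symmetric]) simp

lemma set_discr_pmf: "set_pmf (discr_pmf N h) \<subseteq> A"
  using AE_discr_pmf[of "\<lambda>a. a \<in> A"] h_A by auto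

end

text \<open>A threshold only matters through the set of coupons it accepts, so it is replaced by the
  least attractiveness that is at least as large; the value 2 stands for rejecting everything.\<close>
definition round_threshold :: "real set \<Rightarrow> ('v \<Rightarrow> real \<Rightarrow> real) \<Rightarrow> 'v \<Rightarrow> real \<Rightarrow> real" where
  "round_threshold C p v s = Min (insert 2 {a \<in> p v ` C. s \<le> a})"

definition unif01 :: "real measure" where
  "unif01 = uniform_measure lborel {0..1}"

definition threshold_pmf :: "real set \<Rightarrow> ('v \<Rightarrow> real \<Rightarrow> real) \<Rightarrow> 'v \<Rightarrow> real pmf" where
  "threshold_pmf C p v = discr_pmf unif01 (round_threshold C p v)"

text \<open>The placeholder 2 exceeds every attractiveness and is never accepted; any other rounded
  value is at least \<open>s\<close>.\<close>

lemma round_threshold_le_iff: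
  assumes "finite C" "c \<in> C" "p v c \<le> 1"
  shows "round_threshold C p v s \<le> p v c \<longleftrightarrow> s \<le> p v c"
proof
  have "round_threshold C p v s \<in> insert 2 {a \<in> p v ` C. s \<le> a}"
    unfolding round_threshold_def using assms(1) by (intro Min_in) auto
  then show "s \<le> p v c" if "round_threshold C p v s \<le> p v c"
    using that assms(3) by auto
next
  assume "s \<le> p v c"
  then show "round_threshold C p v s \<le> p v c"
    unfolding round_threshold_def using assms by (intro Min_le) auto
qed

lemma mono_round_threshold: "finite C \<Longrightarrow> mono (round_threshold C p v)"
  unfolding round_threshold_def by (intro monoI Min_antimono) auto

lemma prob_space_unif01: "prob_space unif01"
  unfolding unif01_def by (rule prob_space_uniform_measure) simp_all

lemma finite_valued_round:
  assumes "finite C"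
  shows "finite_valued unif01 (round_threshold C p v) (insert 2 (p v ` C))"
proof -
  note prob_space_unif01
  moreover have "round_threshold C p v s \<in> insert 2 (p v ` C)" for s
    using Min_in[of "insert 2 {a \<in> p v ` C. s \<le> a}"] assms by (auto simp: round_threshold_def)
  moreover have "round_threshold C p v -` {a} \<inter> space unif01 \<in> sets unif01" for a
  proof -
    have "round_threshold C p v \<in> borel_measurable borel"
      using assms by (intro borel_measurable_mono mono_round_threshold)
    then have "round_threshold C p v -` {a} \<inter> space borel \<in> sets borel"
      by (rule measurable_sets) simp
    then show ?thesis by (simp add: unif01_def)
  qed
  ultimately show ?thesis
    using assms unfolding finite_valued_def finite_valued_axioms_def by simp
qed

section \<open>Transfer between uniform and rounded thresholds\<close>

locale coupon_problem =
  fixes V :: "'v set" and C :: "real set" and p :: "'v \<Rightarrow> real \<Rightarrow> real"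
    and I :: "'v set \<Rightarrow> real" and K :: nat and B :: real
  assumes fin_V: "finite V" and fin_C: "finite C" and C_nonneg: "\<And>c. c \<in> C \<Longrightarrow> 0 \<le> c"
    and p01: "\<And>v c. v \<in> V \<Longrightarrow> c \<in> C \<Longrightarrow> p v c \<le> 1"
    and p_mono: "\<And>v c c'. v \<in> V \<Longrightarrow> c \<in> C \<Longrightarrow> c' \<in> C \<Longrightarrow> c \<le> c' \<Longrightarrow> p v c \<le> p v c'"
    and subm: "monotone_submodular V I" and B_nonneg: "0 \<le> B"

sublocale coupon_problem \<subseteq> coupon_model V C p I K B "threshold_pmf C p"
proof
  fix v
  interpret finite_valued unif01 "round_threshold C p v" "insert 2 (p v ` C)"
    by (rule finite_valued_round[OF fin_C])
  show "finite (set_pmf (threshold_pmf C p v))"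
    unfolding threshold_pmf_def using set_discr_pmf fin_A by (rule finite_subset)
qed (use fin_V fin_C C_nonneg p_mono subm B_nonneg in auto)

context coupon_problem
begin

text \<open>The value 0 outside \<open>V\<close> agrees with the default of the product pmf
  \<open>M\<close>.\<close>

definition rnd :: "('v \<Rightarrow> real) \<Rightarrow> 'v \<Rightarrow> real" where
  "rnd \<sigma> v = (if v \<in> V then round_threshold C p v (\<sigma> v) else 0)"

lemma rnd_le_iff: "v \<in> V \<Longrightarrow> c \<in> C \<Longrightarrow> rnd \<sigma> v \<le> p v c \<longleftrightarrow> \<sigma> v \<le> p v c"
  using round_threshold_le_iff[OF fin_C, of c p v] p01[of v c] by (simp add: rnd_def)

lemma thr_space_eq: "thr_space V = PiM V (\<lambda>_. unif01)"
  by (simp add: thr_space_def unif01_def)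

lemma rnd_vimage:
  assumes "\<And>v. v \<notin> V \<Longrightarrow> t v = 0"
  shows "rnd -` {t} \<inter> space (thr_space V) = (\<Pi>\<^sub>E v\<in>V. round_threshold C p v -` {t v} \<inter> space unif01)"
  using assms by (auto simp: rnd_def thr_space_eq space_PiM PiE_iff fun_eq_iff split: if_splits)

lemma finite_valued_rnd: "finite_valued (thr_space V) rnd (PiE_dflt V 0 (\<lambda>v. insert 2 (p v ` C)))"
proof -
  interpret prob_space unif01 by (rule prob_space_unif01)
  interpret finite_product_prob_space "\<lambda>_. unif01" V
    by unfold_locales (rule fin_V)
  have r: "round_threshold C p v s \<in> insert 2 (p v ` C)" for v s
    by (rule finite_valued.h_A[OF finite_valued_round[OF fin_C]])
  have "prob_space (thr_space V)" unfolding thr_space_eq by (rule prob_space_axioms)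
  moreover have "rnd \<sigma> \<in> PiE_dflt V 0 (\<lambda>v. insert 2 (p v ` C))" for \<sigma>
    using r by (auto simp: PiE_dflt_def rnd_def)
  moreover have "rnd -` {t} \<inter> space (thr_space V) \<in> sets (thr_space V)"
    if "t \<in> PiE_dflt V 0 (\<lambda>v. insert 2 (p v ` C))" for t
  proof -
    have t: "t v = 0" if "v \<notin> V" for v using \<open>t \<in> _\<close> that by (auto simp: PiE_dflt_def)
    have eq: "rnd -` {t} \<inter> space (thr_space V) = (\<Pi>\<^sub>E v\<in>V. round_threshold C p v -` {t v} \<inter> space unif01)"
      by (rule rnd_vimage) (rule t)
    show ?thesis unfolding eq unfolding thr_space_eq
    proof (rule sets_PiM_I_finite[OF fin_V])
      fix v assume "v \<in> V"
      then show "round_threshold C p v -` {t v} \<inter> space unif01 \<in> sets unif01"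
        using that by (intro finite_valued.h_sets[OF finite_valued_round[OF fin_C]]) (auto simp: PiE_dflt_def)
    qed
  qed
  moreover have "finite (PiE_dflt V 0 (\<lambda>v. insert 2 (p v ` C)))"
    using fin_V fin_C by (intro finite_PiE_dflt) auto
  ultimately show ?thesis
    unfolding finite_valued_def finite_valued_axioms_def by simp
qed

text \<open>The fibre of a rounded vector is a box, so its probability factors over the users;
  vectors that are nonzero somewhere outside \<open>V\<close> get probability 0 on both
  sides.\<close>

lemma discr_pmf_rnd: "discr_pmf (thr_space V) rnd = M"
proof (rule pmf_eqI)
  fix t
  interpret R: finite_valued "thr_space V" rnd "PiE_dflt V 0 (\<lambda>v. insert 2 (p v ` C))"
    by (rule finite_valued_rnd)
  interpret U: prob_space unif01 by (rule prob_space_unif01)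
  interpret P: finite_product_prob_space "\<lambda>_. unif01" V
    by unfold_locales (rule fin_V)
  show "pmf (discr_pmf (thr_space V) rnd) t = pmf M t"
  proof (cases "\<forall>v. v \<notin> V \<longrightarrow> t v = 0")
    case True
    then have eq: "rnd -` {t} \<inter> space (thr_space V) = (\<Pi>\<^sub>E v\<in>V. round_threshold C p v -` {t v} \<inter> space unif01)"
      by (intro rnd_vimage) blast
    have sets: "round_threshold C p v -` {a} \<inter> space unif01 \<in> sets unif01" for v a
    proof -
      interpret T: finite_valued unif01 "round_threshold C p v" "insert 2 (p v ` C)"
        by (rule finite_valued_round[OF fin_C])
      from T.h_measurable show ?thesis by (rule measurable_sets) simp
    qed
    have "pmf (discr_pmf (thr_space V) rnd) t
      = measure (PiM V (\<lambda>_. unif01)) (\<Pi>\<^sub>E v\<in>V. round_threshold C p v -` {t v} \<inter> space unif01)"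
      unfolding R.pmf_discr_pmf eq unfolding thr_space_eq ..
    also have "\<dots> = (\<Prod>v\<in>V. measure unif01 (round_threshold C p v -` {t v} \<inter> space unif01))"
      using sets by (intro P.prob_times) simp
    also have "\<dots> = (\<Prod>v\<in>V. pmf (threshold_pmf C p v) (t v))"
      by (simp only: threshold_pmf_def finite_valued.pmf_discr_pmf[OF finite_valued_round[OF fin_C]])
    also have "\<dots> = pmf M t" using True fin_V by (simp add: pmf_Pi)
    finally show ?thesis .
  next
    case False
    then obtain v where v: "v \<notin> V" "t v \<noteq> 0" by blast
    then have "rnd -` {t} = {}" by (auto simp: rnd_def)
    then show ?thesis using v fin_V by (auto simp: pmf_Pi R.pmf_discr_pmf)
  qed
qed

lemma integral_rnd: "(\<integral>\<sigma>. g (rnd \<sigma>) \<partial>thr_space V) = expect M g"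
  using finite_valued.expect_discr_pmf[OF finite_valued_rnd, of g] by (simp add: discr_pmf_rnd)

lemma AE_rnd: "(AE \<sigma> in thr_space V. P (rnd \<sigma>)) \<longleftrightarrow> (\<forall>t\<in>set_pmf M. P t)"
  using finite_valued.AE_discr_pmf[OF finite_valued_rnd, of P] by (simp add: discr_pmf_rnd)

lemma rnd_measurable: "(\<lambda>\<sigma>. g (rnd \<sigma>) :: real) \<in> borel_measurable (thr_space V)"
  by (rule measurable_compose[OF finite_valued.h_measurable[OF finite_valued_rnd]]) simp

lemma fset_eq: "A \<subseteq> S \<Longrightarrow> fset V p I A = f A"
proof -
  assume A: "A \<subseteq> S"
  have "{v \<in> V. \<exists>\<psi>. (v, \<psi>) \<in> A \<and> (\<exists>c \<in> set \<psi>. \<sigma> v \<le> p v c)} = Acc A (rnd \<sigma>)" for \<sigma>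
  proof -
    have "rnd \<sigma> v \<le> p v c \<longleftrightarrow> \<sigma> v \<le> p v c" if "v \<in> V" "(v, \<psi>) \<in> A" "c \<in> set \<psi>" for v \<psi> c
      using that A Q_small[of \<psi> c] by (intro rnd_le_iff) (auto simp: Actions_def)
    then show ?thesis by (fastforce simp: Acc_def acc_def)
  qed
  then show ?thesis using integral_rnd[of "\<lambda>t. I (Acc A t)"] by (simp add: fset_def f_def)
qed

lemma omega_eq: "s \<in> S \<Longrightarrow> omega V C p I K B y s = gain y s"
proof -
  assume s: "s \<in> S"
  have "expect (sample S y) (\<lambda>R. fset V p I (R \<union> {s})) = expect (sample S y) (\<lambda>R. f (R \<union> {s}))"
    using s by (intro expect_sample_cong fset_eq) auto
  moreover have "expect (sample S y) (fset V p I) = expect (sample S y) f"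
    by (intro expect_sample_cong fset_eq)
  ultimately show ?thesis
    by (simp add: omega_def gain_def expect_diff[OF finite_set_sample[OF fin_S]])
qed

lemma bcost_eq: "s \<in> S \<Longrightarrow> bcost p (fst s) (snd s) = cost s"
proof -
  assume s: "s \<in> S"
  have "pay p (fst s) (snd s) r = pay p (fst s) (snd s) (round_threshold C p (fst s) r)" for r
  proof -
    have "(r \<le> p (fst s) c) = (round_threshold C p (fst s) r \<le> p (fst s) c)" if "c \<in> set (snd s)" for c
      using that s Q_small[of "snd s" c] round_threshold_le_iff[OF fin_C, of c p "fst s"] p01
      by (auto simp: Actions_def)
    then have "find (\<lambda>c. r \<le> p (fst s) c) (snd s) = find (\<lambda>c. round_threshold C p (fst s) r \<le> p (fst s) c) (snd s)"
      by (intro find_cong) auto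
    then show ?thesis by (simp add: pay_def)
  qed
  then have "bcost p (fst s) (snd s) = (\<integral>r. pay p (fst s) (snd s) (round_threshold C p (fst s) r) \<partial>unif01)"
    unfolding bcost_def unif01_def by (rule Bochner_Integration.integral_cong[OF refl])
  also have "\<dots> = cost s"
    unfolding cost_def threshold_pmf_def
    by (rule finite_valued.expect_discr_pmf[OF finite_valued_round[OF fin_C], symmetric])
  finally show ?thesis .
qed

lemma lp_feasible_eq: "lp_feasible V C p K B \<beta> z \<longleftrightarrow> lp_feas \<beta> z"
proof -
  have "(\<Sum>s\<in>S. z s * bcost p (fst s) (snd s)) = (\<Sum>s\<in>S. z s * cost s)"
    by (intro sum.cong) (simp_all add: bcost_eq)
  then show ?thesis by (simp add: lp_feasible_def lp_feas_def)
qed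

text \<open>Thresholds enter a run only through comparisons, and rounding preserves those between
  users of \<open>V\<close> and coupons of \<open>C\<close>; hence the assumption on the original
  run.\<close>

lemma run_rnd:
  assumes "\<And>n v c a. (v, c, a) \<in> set (run p \<pi> \<sigma> n) \<Longrightarrow> v \<in> V \<and> c \<in> C"
  shows "run p \<pi> \<sigma> n = run p \<pi> (rnd \<sigma>) n"
proof (induction n)
  case (Suc n)
  show ?case
  proof (cases "\<pi> (run p \<pi> \<sigma> n)")
    case None
    then show ?thesis using Suc by (simp add: Let_def)
  next
    case (Some e)
    obtain v c where e: "e = (v, c)" by (cases e)
    have "(v, c, \<sigma> v \<le> p v c) \<in> set (run p \<pi> \<sigma> (Suc n))" using Some e by (simp add: Let_def)
    from assms[OF this] have "rnd \<sigma> v \<le> p v c \<longleftrightarrow> \<sigma> v \<le> p v c" by (intro rnd_le_iff) auto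
    then show ?thesis using Suc Some e by (simp add: Let_def)
  qed
qed simp

lemma utility_det_eq:
  assumes "\<And>h v c. \<pi> h = Some (v, c) \<Longrightarrow> v \<in> V \<and> c \<in> C"
  shows "utility_det V p I \<pi> = expect M (\<lambda>t. I (accepted p \<pi> t))"
proof -
  have "v \<in> V \<and> c \<in> C" if "(v, c, a) \<in> set (run p \<pi> \<sigma> n)" for v c a n \<sigma>
    using that assms by (induction n) (auto simp: Let_def split: option.splits)
  then have "accepted p \<pi> \<sigma> = accepted p \<pi> (rnd \<sigma>)" for \<sigma>
    unfolding accepted_def by (subst run_rnd) auto
  then show ?thesis
    unfolding utility_det_def integral_rnd[symmetric] by simp
qed

lemma utility_seqpol:
  assumes "set L \<subseteq> S"
  shows "utility_det V p I (seqpol B B L) = expect M (\<lambda>t. I (accepted p (seqpol B B L) t))"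
proof (rule utility_det_eq)
  fix h v c assume h: "seqpol B B L h = Some (v, c)"
  obtain s where s: "s \<in> set L" "c \<in> set (snd s)" "fst s = v" using seqpol_action[OF h] by blast
  have "snd s \<in> Q" using s(1) assms by (auto simp: Actions_def)
  from Q_small[OF this s(2)] s assms show "v \<in> V \<and> c \<in> C" by (auto simp: Actions_def)
qed

lemma utility_alg2:
  assumes "valid_alg2_order V I us" "C \<noteq> {}"
  shows "utility_det V p I (alg2 us (Max C)) = expect M (\<lambda>t. I (accepted p (alg2 us (Max C)) t))"
  using assms fin_C
  by (intro utility_det_eq) (auto simp: alg2_def valid_alg2_order_def split: if_splits)

text \<open>Where the constraints hold, the run equals the rounded run, so they hold there too; an
  almost sure property of rounded thresholds holds at every point of the finite support.\<close>

lemma feasible_rnd: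
  assumes "feasible_det V C p K B \<pi>"
  shows "AE \<sigma> in thr_space V. accepted p \<pi> \<sigma> = accepted p \<pi> (rnd \<sigma>)"
    and "\<And>t n. t \<in> set_pmf M \<Longrightarrow> (\<forall>(v, c, a)\<in>set (run p \<pi> t n). v \<in> V \<and> c \<in> C)
       \<and> (\<forall>v. probes v (run p \<pi> t n) \<le> K) \<and> paid (run p \<pi> t n) \<le> B"
proof -
  let ?P = "\<lambda>t. \<forall>n. (\<forall>(v, c, a)\<in>set (run p \<pi> t n). v \<in> V \<and> c \<in> C)
       \<and> (\<forall>v. probes v (run p \<pi> t n) \<le> K) \<and> paid (run p \<pi> t n) \<le> B"
  have P: "AE \<sigma> in thr_space V. ?P \<sigma>" using assms by (simp add: feasible_det_def Let_def)
  have r: "run p \<pi> \<sigma> n = run p \<pi> (rnd \<sigma>) n" if "?P \<sigma>" for \<sigma> n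
    using that by (intro run_rnd) blast
  from P show "AE \<sigma> in thr_space V. accepted p \<pi> \<sigma> = accepted p \<pi> (rnd \<sigma>)"
  proof eventually_elim
    case (elim \<sigma>)
    from r[OF elim] show ?case unfolding accepted_def by simp
  qed
  have "AE \<sigma> in thr_space V. ?P (rnd \<sigma>)"
    using P
  proof eventually_elim
    case (elim \<sigma>)
    with r[OF elim] show ?case by simp
  qed
  then have "\<forall>t\<in>set_pmf M. ?P t" unfolding AE_rnd[of ?P] .
  then show "(\<forall>(v, c, a)\<in>set (run p \<pi> t n). v \<in> V \<and> c \<in> C)
       \<and> (\<forall>v. probes v (run p \<pi> t n) \<le> K) \<and> paid (run p \<pi> t n) \<le> B" if "t \<in> set_pmf M" for t n
    using that by blast
qed

text \<open>Only an inequality: on a null set the policy may behave arbitrarily, which can make the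
  integrand non-measurable and the integral 0.\<close>
lemma utility_det_le:
  assumes "feasible_det V C p K B \<pi>"
  shows "utility_det V p I \<pi> \<le> expect M (\<lambda>t. I (accepted p \<pi> t))"
proof (cases "integrable (thr_space V) (\<lambda>\<sigma>. I (accepted p \<pi> \<sigma>))")
  case True
  have "utility_det V p I \<pi> = (\<integral>\<sigma>. I (accepted p \<pi> (rnd \<sigma>)) \<partial>thr_space V)"
    unfolding utility_det_def
    using True feasible_rnd(1)[OF assms]
    by (intro integral_cong_AE rnd_measurable[of "\<lambda>t. I (accepted p \<pi> t)"]) (auto elim: eventually_mono)
  then show ?thesis by (simp add: integral_rnd[of "\<lambda>t. I (accepted p \<pi> t)"])
next
  case False
  have "0 \<le> I (accepted p \<pi> t)" if "t \<in> set_pmf M" for t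
    using feasible_rnd(2)[OF assms that] by (intro I_nonneg) (fastforce simp: accepted_def)
  then have "0 \<le> expect M (\<lambda>t. I (accepted p \<pi> t))" by (intro expect_nonneg)
  then show ?thesis using False by (simp add: utility_det_def not_integrable_integral_eq)
qed

end

subsection \<open>The approximation guarantee\<close>

context coupon_problem
begin

context
  fixes \<beta> :: real and ys :: "nat \<Rightarrow> 'v \<times> real list \<Rightarrow> real"
    and crs :: "('v \<times> real list \<Rightarrow> real) \<Rightarrow> ('v \<times> real list) set \<Rightarrow> ('v \<times> real list) set pmf"
    and ord :: "('v \<times> real list) set \<Rightarrow> ('v \<times> real list) list" and us :: "'v list"
  assumes \<beta>: "0 \<le> \<beta>" "\<beta> \<le> 1 / 2"
    and greedy: "continuous_greedy_run V C p I K B \<beta> ys"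
    and crs: "is_CRS V Q crs" "CRS_monotone V Q crs" "CRS_balanced V Q crs (1 - exp (- 1))"
    and ord: "valid_order ord S"
    and us: "valid_alg2_order V I us"
begin

abbreviation "yg \<equiv> greedy_output V C K B ys"
abbreviation "\<delta> \<equiv> greedy_delta V C K B"
abbreviation "steps \<equiv> greedy_steps V C K B"

lemma card_Q_pos: "0 < card Q"
  using Nil_in_Q fin_Q by (auto simp: card_gt_0_iff)

lemma delta_nonneg: "0 \<le> \<delta>"
  by (simp add: greedy_delta_def)

lemma steps_delta: "V \<noteq> {} \<Longrightarrow> steps * \<delta> = 1"
  using card_Q_pos fin_V by (simp add: greedy_delta_def greedy_steps_def card_gt_0_iff)

text \<open>Here \<delta> is 1 / N^2 with N at least \<open>card V\<close>, because \<open>Q\<close>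
  contains the empty list. For empty \<open>V\<close>, \<delta> is 1 / 0 = 0.\<close>

lemma delta_card: "\<delta> * card V \<le> 1" "\<delta> * card V * card V \<le> 1" "\<delta> \<le> 1"
proof -
  have *: "\<delta> * real m \<le> 1" if "m \<le> (card V * card Q)\<^sup>2" for m
  proof (cases "(card V * card Q)\<^sup>2 = 0")
    case False
    have "\<delta> * real m \<le> \<delta> * real ((card V * card Q)\<^sup>2)"
      using that delta_nonneg by (intro mult_left_mono of_nat_mono)
    also have "\<dots> = 1" using False by (simp add: greedy_delta_def)
    finally show ?thesis .
  next
    case True
    then show ?thesis unfolding greedy_delta_def by (simp only:) simp
  qed
  have 1: "card V * card V \<le> (card V * card Q)\<^sup>2"
    using mult_le_mono[of "card V" "card V * card Q" "card V" "card V * card Q"] card_Q_pos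
    by (simp add: power2_eq_square)
  have 2: "card V \<le> card V * card V" by (cases "card V") auto
  show "\<delta> * card V \<le> 1" by (rule *) (use 1 2 in linarith)
  show "\<delta> * card V * card V \<le> 1" using *[OF 1] by (simp add: mult.assoc)
  show "\<delta> \<le> 1" unfolding greedy_delta_def
    by (cases "(card V * card Q)\<^sup>2") auto
qed

lemma greedy_step:
  assumes "k < steps"
  shows "\<exists>z. lp_feas \<beta> z
    \<and> (\<forall>z'. lp_feas \<beta> z' \<longrightarrow> (\<Sum>s\<in>S. gain (ys k) s * z' s) \<le> (\<Sum>s\<in>S. gain (ys k) s * z s))
    \<and> ys (Suc k) = (\<lambda>s. ys k s + \<delta> * z s)"
proof -
  have "(\<Sum>s\<in>S. omega V C p I K B (ys k) s * z s) = (\<Sum>s\<in>S. gain (ys k) s * z s)" for z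
    by (intro sum.cong) (simp_all add: omega_eq)
  moreover have "\<exists>z. lp_optimal V C p K B \<beta> (omega V C p I K B (ys k)) z \<and> ys (Suc k) = (\<lambda>s. ys k s + \<delta> * z s)"
    using greedy assms unfolding continuous_greedy_run_def by blast
  ultimately show ?thesis
    unfolding lp_optimal_def lp_feasible_eq by simp
qed

lemma yg_feasible: "yg \<in> partition_polytope V Q" "(\<Sum>s\<in>S. yg s * cost s) \<le> \<beta> * B"
proof -
  have "yg \<in> partition_polytope V Q \<and> (\<Sum>s\<in>S. yg s * cost s) \<le> \<beta> * B"
  proof (cases "V = {}")
    case True
    then show ?thesis using \<beta> B_nonneg by (simp add: partition_polytope_def Actions_def)
  next
    case False
    have ys0: "ys 0 = (\<lambda>_. 0)" using greedy by (simp add: continuous_greedy_run_def)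
    have "\<exists>z. lp_feas \<beta> z \<and> ys (Suc k) = (\<lambda>s. ys k s + \<delta> * z s)" if "k < steps" for k
      using greedy_step[OF that] by blast
    from greedy_feasible[where ys = ys and n = steps and k = steps, OF delta_nonneg \<beta>(1) ys0 this]
    have "(\<forall>s\<in>S. 0 \<le> yg s \<and> yg s \<le> steps * \<delta>) \<and> (\<forall>v\<in>V. (\<Sum>q\<in>Q. yg (v, q)) \<le> steps * \<delta>)
      \<and> (\<Sum>s\<in>S. yg s * cost s) \<le> steps * \<delta> * (\<beta> * B)"
      unfolding greedy_output_def by simp
    then show ?thesis
      unfolding steps_delta[OF False] by (simp add: partition_polytope_def Actions_def)
  qed
  then show "yg \<in> partition_polytope V Q" "(\<Sum>s\<in>S. yg s * cost s) \<le> \<beta> * B" by blast+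
qed

abbreviation "PZ \<equiv> bind_pmf (sample S yg) (crs yg)"
abbreviation "u1 \<equiv> expect PZ (\<lambda>Z. utility_det V p I (seqpol B B (ord Z)))"
abbreviation "u2 \<equiv> utility_det V p I (alg2 us (Max C))"

lemma set_PZ: "Z \<in> set_pmf PZ \<Longrightarrow> Z \<subseteq> S"
proof -
  assume "Z \<in> set_pmf PZ"
  then obtain R where R: "R \<in> set_pmf (sample S yg)" "Z \<in> set_pmf (crs yg R)" by auto
  from R(1) set_sample have "R \<subseteq> V \<times> Q" by (auto simp: Actions_def)
  with R(2) crs(1) yg_feasible(1) have "Z \<subseteq> R" unfolding is_CRS_def by blast
  with \<open>R \<subseteq> V \<times> Q\<close> show "Z \<subseteq> S" by (auto simp: Actions_def)
qed

lemma finite_PZ: "finite (set_pmf PZ)"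
  by (rule finite_subset[of _ "Pow S"]) (use set_PZ fin_S in auto)

lemma ord_Z: "Z \<in> set_pmf PZ \<Longrightarrow> set (ord Z) \<subseteq> S"
  using ord set_PZ by (auto simp: valid_order_def)

lemma utility_stoch_CP: "utility V p I (stoch_CP (alg1 B S yg crs ord) (alg2 us (Max C))) = (u1 + u2) / 2"
proof -
  let ?P = "alg1 B S yg crs ord"
  let ?U = "utility_det V p I"
  have fin: "finite (set_pmf (if b then ?P else return_pmf (alg2 us (Max C))))" for b
    using finite_PZ by (simp add: alg1_def del: set_bind_pmf)
  have "utility V p I (stoch_CP ?P (alg2 us (Max C)))
      = expect (bernoulli_pmf (1 / 2)) (\<lambda>b. expect (if b then ?P else return_pmf (alg2 us (Max C))) ?U)"
    unfolding utility_def stoch_CP_def using fin by (intro expect_bind) auto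
  also have "\<dots> = (expect ?P ?U + u2) / 2" by simp
  also have "expect ?P ?U = u1" by (simp add: alg1_def)
  finally show ?thesis .
qed

lemma u1_ge: "(1 - exp (- 1)) * (1 - 2 * \<beta>) * F yg \<le> u1"
proof -
  have "(1 - exp (- 1)) * (1 - 2 * \<beta>) * F yg
      \<le> expect PZ (\<lambda>Z. expect M (\<lambda>t. I (accepted p (seqpol B B (ord Z)) t)))"
    using yg_feasible \<beta> crs ord by (intro alg1_value_ge) auto
  also have "\<dots> = u1" by (intro expect_cong) (simp add: utility_seqpol ord_Z)
  finally show ?thesis .
qed

lemma u1_nonneg: "0 \<le> u1"
proof -
  have "0 \<le> (1 - exp (- 1)) * (1 - 2 * \<beta>) * F yg"
    using \<beta> F_nonneg by (intro mult_nonneg_nonneg) auto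
  also note u1_ge
  finally show ?thesis .
qed

lemma u2_nonneg: "0 \<le> u2"
  unfolding utility_det_def using us by (intro Bochner_Integration.integral_nonneg I_nonneg accepted_alg2_subset)

text \<open>\<open>u2\<close> is charged twice at rate \<alpha>: for the user who redeems a large
  coupon and for the discretisation loss of continuous greedy. The bound 2 \<alpha> \<le> 1 makes
  room for both.\<close>

lemma policy_det_bound:
  assumes \<pi>: "feasible_det V C p K B \<pi>"
  shows "(1 - exp (- 1)) * (1 - \<beta>) * (1 - 2 * \<beta>) * \<beta> * utility_det V p I \<pi> \<le> u1 + u2"
proof (cases "C = {}")
  \<comment> \<open>\<open>Max C\<close> is unspecified here, but a feasible policy then makes no
    offer.\<close>
  case True
  have "accepted p \<pi> t = {}" if "t \<in> set_pmf M" for t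
    using feasible_rnd(2)[OF \<pi> that] True by (fastforce simp: accepted_def)
  then have "expect M (\<lambda>t. I (accepted p \<pi> t)) = expect M (\<lambda>t. 0)"
    by (intro expect_cong) (simp add: I_empty)
  with utility_det_le[OF \<pi>] have "utility_det V p I \<pi> \<le> 0" by simp
  then have "(1 - exp (- 1)) * (1 - \<beta>) * (1 - 2 * \<beta>) * \<beta> * utility_det V p I \<pi> \<le> 0"
    using \<beta> by (intro mult_nonneg_nonpos mult_nonneg_nonneg) auto
  with u1_nonneg u2_nonneg show ?thesis by linarith
next
  case False
  define \<alpha> where "\<alpha> = (1 - exp (- 1)) * (1 - \<beta>) * (1 - 2 * \<beta>) * \<beta>"
  have \<alpha>: "0 \<le> \<alpha>" "2 * \<alpha> \<le> 1"
  proof -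
    show "0 \<le> \<alpha>" unfolding \<alpha>_def using \<beta> by (intro mult_nonneg_nonneg) auto
    have "(1 - exp (- 1)) * (1 - \<beta>) * (1 - 2 * \<beta>) * \<beta> \<le> 1 * 1 * 1 * (1 / 2 :: real)"
      using \<beta> by (intro mult_mono mult_nonneg_nonneg) auto
    then show "2 * \<alpha> \<le> 1" by (simp add: \<alpha>_def)
  qed
  obtain O' :: real and x where x: "\<And>s. s \<in> S \<Longrightarrow> 0 \<le> x s \<and> x s \<le> 1" "\<And>v. v \<in> V \<Longrightarrow> (\<Sum>q\<in>Q. x (v, q)) = 1"
    "(\<Sum>s\<in>S. x s * cost s) \<le> B" "\<And>y. O' - 2 * F y \<le> (\<Sum>s\<in>S. gain y s * x s)"
    "0 \<le> O'" and O': "O' \<le> card V * u2" "expect M (\<lambda>t. I (accepted p \<pi> t)) \<le> O' + u2"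
    by (rule policy_bound[OF us _ utility_alg2[OF us False]], erule feasible_rnd(2)[OF \<pi>]) (rule that)
  have "\<alpha> * O' - \<alpha> * u2 \<le> u1"
  proof (cases "V = {}")
    case True
    then have "O' = 0" using O'(1) x(5) by simp
    moreover have "0 \<le> \<alpha> * u2" using \<alpha> u2_nonneg by simp
    ultimately show ?thesis using u1_nonneg by simp
  next
    case V: False
    have "ys 0 = (\<lambda>_. 0)" using greedy by (simp add: continuous_greedy_run_def)
    from greedy_value[where ys = ys, OF steps_delta[OF V] delta_nonneg delta_card(1,3) \<beta> this greedy_step x]
    have G: "(1 - \<delta> * card V) * (\<beta> * (1 - \<beta>) * O') \<le> F yg" by (simp add: greedy_output_def)
    \<comment> \<open>The lost fraction \<delta> \<open>card V\<close> of \<open>O'\<close> is worth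
      at most \<open>u2\<close>: one factor \<open>card V\<close> comes from the bound on
      \<open>O'\<close>, and \<delta> was chosen to absorb its square.\<close>
    have "\<delta> * card V * O' \<le> \<delta> * card V * (card V * u2)"
      using O'(1) delta_nonneg by (intro mult_left_mono) auto
    also have "\<dots> = (\<delta> * card V * card V) * u2" by simp
    also have "\<dots> \<le> 1 * u2" using delta_card(2) u2_nonneg by (intro mult_right_mono)
    finally have "\<alpha> * (O' - u2) \<le> \<alpha> * ((1 - \<delta> * card V) * O')"
      using \<alpha> by (intro mult_left_mono) (auto simp: algebra_simps)
    also have "\<dots> = (1 - exp (- 1)) * (1 - 2 * \<beta>) * ((1 - \<delta> * card V) * (\<beta> * (1 - \<beta>) * O'))"
      by (simp add: \<alpha>_def)
    also have "\<dots> \<le> (1 - exp (- 1)) * (1 - 2 * \<beta>) * F yg"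
      using \<beta> by (intro mult_left_mono G mult_nonneg_nonneg) auto
    also note u1_ge
    finally show ?thesis by (simp add: algebra_simps)
  qed
  moreover have "\<alpha> * utility_det V p I \<pi> \<le> \<alpha> * (O' + u2)"
    using utility_det_le[OF \<pi>] O'(2) \<alpha> by (intro mult_left_mono) auto
  moreover have "2 * \<alpha> * u2 \<le> 1 * u2" using \<alpha> u2_nonneg by (intro mult_right_mono)
  ultimately show ?thesis unfolding \<alpha>_def[symmetric] by (simp add: algebra_simps)
qed

text \<open>Witness that the supremum in \<open>OPT\<close> ranges over a nonempty set.\<close>

lemma feasible_stop: "feasible V C p K B (return_pmf (\<lambda>_. None))"
proof -
  have "run p (\<lambda>_. None) \<sigma> n = []" for \<sigma> :: "'v \<Rightarrow> real" and n by (induction n) (simp_all add: Let_def)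
  then show ?thesis using B_nonneg by (simp add: feasible_def feasible_det_def probes_def paid_def)
qed

text \<open>The bound for deterministic policies is uniform, hence passes to mixtures and to the
  supremum. Dividing by \<alpha> needs \<alpha> > 0; for \<alpha> = 0 nonnegativity of the utilities
  suffices.\<close>

lemma stoch_CP_approximation:
  "(1 - exp (- 1)) * (1 - \<beta>) * (1 - 2 * \<beta>) * \<beta> / 2 * OPT V C p I K B
    \<le> utility V p I (stoch_CP (alg1 B S yg crs ord) (alg2 us (Max C)))"
proof -
  define \<alpha> where "\<alpha> = (1 - exp (- 1)) * (1 - \<beta>) * (1 - 2 * \<beta>) * \<beta>"
  have \<alpha>: "0 \<le> \<alpha>" unfolding \<alpha>_def using \<beta> by (intro mult_nonneg_nonneg) auto
  have "\<alpha> * OPT V C p I K B \<le> u1 + u2"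
  proof (cases "\<alpha> = 0")
    case True
    then show ?thesis using u1_nonneg u2_nonneg by simp
  next
    case False
    then have pos: "0 < \<alpha>" using \<alpha> by simp
    let ?b = "(u1 + u2) / \<alpha>"
    have b0: "0 \<le> ?b" using u1_nonneg u2_nonneg \<alpha> by simp
    have det: "utility_det V p I \<pi> \<le> ?b" if "feasible_det V C p K B \<pi>" for \<pi>
      using policy_det_bound[OF that, folded \<alpha>_def] pos by (simp add: pos_le_divide_eq mult.commute)
    have "utility V p I P \<le> ?b" if P: "feasible V C p K B P" for P
    proof (cases "integrable (measure_pmf P) (utility_det V p I)")
      case True
      have "utility V p I P \<le> expect P (\<lambda>_. ?b)"
        unfolding utility_def using True det P
        by (intro integral_mono_AE) (auto simp: AE_measure_pmf_iff feasible_def)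
      then show ?thesis by simp
    next
      \<comment> \<open>A non-integrable utility has expectation 0 by convention, which the
        nonnegative \<open>?b\<close> still bounds.\<close>
      case False
      then show ?thesis using b0 by (simp add: utility_def not_integrable_integral_eq)
    qed
    then have "OPT V C p I K B \<le> ?b"
      unfolding OPT_def using feasible_stop by (intro cSup_least) auto
    then show ?thesis using pos by (simp add: field_simps)
  qed
  then show ?thesis unfolding utility_stoch_CP \<alpha>_def by simp
qed

end

end

theorem theorem1:
  fixes V :: "'v set" and C :: "real set" and p :: "'v \<Rightarrow> real \<Rightarrow> real"
    and I :: "'v set \<Rightarrow> real" and K :: nat and B \<beta> :: real
    and ys :: "nat \<Rightarrow> 'v \<times> real list \<Rightarrow> real"
    and crs :: "('v \<times> real list \<Rightarrow> real) \<Rightarrow> ('v \<times> real list) set \<Rightarrow> ('v \<times> real list) set pmf"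
    and ord :: "('v \<times> real list) set \<Rightarrow> ('v \<times> real list) list"
    and us :: "'v list"
  assumes "finite V" and "finite C" and "\<forall>c \<in> C. 0 \<le> c"
    and "\<forall>v \<in> V. \<forall>c \<in> C. 0 \<le> p v c \<and> p v c \<le> 1"
    and "\<forall>v \<in> V. \<forall>c \<in> C. \<forall>c' \<in> C. c \<le> c' \<longrightarrow> p v c \<le> p v c'"
    and "monotone_submodular V I"
    and "0 \<le> B" and "0 \<le> \<beta>" and "\<beta> \<le> 1/2"
    and "continuous_greedy_run V C p I K B \<beta> ys"
    and "is_CRS V (Psi C K B) crs" and "CRS_monotone V (Psi C K B) crs"
    and "CRS_balanced V (Psi C K B) crs (1 - exp (-1))"
    and "valid_order ord (Actions V C K B)"
    and "valid_alg2_order V I us"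
  shows "utility V p I
           (stoch_CP (alg1 B (Actions V C K B) (greedy_output V C K B ys) crs ord) (alg2 us (Max C)))
         \<ge> (1 - exp (-1)) * (1 - \<beta>) * (1 - 2 * \<beta>) * \<beta> / 2 * OPT V C p I K B"
proof -
  interpret coupon_problem V C p I K B
    using assms(1-7) by unfold_locales auto
  show ?thesis using assms(8-) by (rule stoch_CP_approximation)
qed

end
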